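(* Let $(X,J)$ be an almost complex manifold with $\dim_{\mathbb{R}} X \geq 4$, and let $\Omega \subset X$ be a relatively compact domain that admits a $\mathcal{C}^2$-smooth strictly $J$-plurisubharmonic exhaustion function $\varphi \colon \Omega \to \mathbb{R}$. Then the boundary $\partial \Omega$ of $\Omega$ in $X$ is connected.
   Context: A domain is a non-empty connected open subset; it is relatively compact if its closure in $X$ is compact. An almost complex manifold $(X,J)$ is a smooth manifold $X$ with a smooth bundle endomorphism $J$ of $TX$ satisfying $J^2 = -\mathrm{id}$ (not assumed integrable). A $\mathcal{C}^2$-smooth function $\varphi \colon \Omega \to \mathbb{R}$ is strictly $J$-plurisubharmonic if, with $d^c_J\varphi := -\,d\varphi\circ J$, one has $dd^c_J\varphi(v,Jv) > 0$ for every non-zero tangent vector $v \in T\Omega$. An exhaustion function is one for which all sublevel sets $\{x \in \Omega : \varphi(x) \leq c\}$, $c \in \mathbb{R}$, are compact. No regularity of the boundary $\partial\Omega$ is assumed. *)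

theory Defs
  imports "HOL-Analysis.Analysis"
begin

text \<open>
  Differentiability of class \<open>C\<^sup>k\<close> on an open set \<open>S\<close> of a Euclidean space: since the domain is
  finite-dimensional, continuity of the \<open>k\<close>-th derivative may be tested on fixed directions.
\<close>

fun C_k_on :: "nat \<Rightarrow> 'a::euclidean_space set \<Rightarrow> ('a \<Rightarrow> 'b::real_normed_vector) \<Rightarrow> bool" where
  "C_k_on 0 S f \<longleftrightarrow> continuous_on S f"
| "C_k_on (Suc k) S f \<longleftrightarrow>
     (\<forall>y\<in>S. f differentiable (at y)) \<and>
     (\<forall>u. C_k_on k S (\<lambda>y. frechet_derivative f (at y) u))"

definition C_infinity_on :: "'a::euclidean_space set \<Rightarrow> ('a \<Rightarrow> 'b::real_normed_vector) \<Rightarrow> bool" where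
  "C_infinity_on S f \<longleftrightarrow> (\<forall>k. C_k_on k S f)"

text \<open>
  A chart is a pair of a domain and a coordinate map; the values of the coordinate map outside
  the domain are irrelevant.
\<close>

type_synonym ('x, 'e) chart = "'x set \<times> ('x \<Rightarrow> 'e)"

abbreviation chart_dom :: "('x, 'e) chart \<Rightarrow> 'x set" where
  "chart_dom c \<equiv> fst c"

abbreviation chart_map :: "('x, 'e) chart \<Rightarrow> 'x \<Rightarrow> 'e" where
  "chart_map c \<equiv> snd c"

definition chart_inv :: "('x, 'e) chart \<Rightarrow> 'e \<Rightarrow> 'x" where
  "chart_inv c = inv_into (chart_dom c) (chart_map c)"

text \<open>
  The manifold is the whole (Hausdorff, second countable) type \<open>'x\<close>, modelled on the Euclidean
  space \<open>'e\<close>, so that its dimension is \<open>DIM('e)\<close>. The atlas need not be maximal.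
\<close>

definition smooth_atlas ::
    "('x::{t2_space,second_countable_topology}, 'e::euclidean_space) chart set \<Rightarrow> bool" where
  "smooth_atlas A \<longleftrightarrow>
     (\<Union>c\<in>A. chart_dom c) = UNIV \<and>
     (\<forall>c\<in>A. open (chart_dom c) \<and> open (chart_map c ` chart_dom c) \<and>
        homeomorphism (chart_dom c) (chart_map c ` chart_dom c) (chart_map c) (chart_inv c)) \<and>
     (\<forall>c\<in>A. \<forall>d\<in>A. C_infinity_on (chart_map c ` (chart_dom c \<inter> chart_dom d))
        (chart_map d \<circ> chart_inv c))"

text \<open>
  A tangent vector at \<open>x\<close> is the family of its coordinate vectors in all charts around \<open>x\<close>, any two
  of which are related by the derivative of the change of coordinates. The family is set to \<open>0\<close>
  at all other arguments, so that each tangent vector has exactly one representation and the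
  vector space operations are the pointwise ones.
\<close>

type_synonym ('x, 'e) tangent_vector = "('x, 'e) chart \<Rightarrow> 'e"

definition tangent_space ::
    "('x, 'e::euclidean_space) chart set \<Rightarrow> 'x \<Rightarrow> ('x, 'e) tangent_vector set" where
  "tangent_space A x =
     {v. (\<forall>c. c \<notin> A \<or> x \<notin> chart_dom c \<longrightarrow> v c = 0) \<and>
         (\<forall>c\<in>A. \<forall>d\<in>A. x \<in> chart_dom c \<inter> chart_dom d \<longrightarrow>
            v d = frechet_derivative (chart_map d \<circ> chart_inv c) (at (chart_map c x)) (v c))}"

text \<open>The tangent vector at \<open>x\<close> with coordinate vector \<open>u\<close> in the chart \<open>c\<close> around \<open>x\<close>.\<close>

definition coord_vector ::
    "('x, 'e::euclidean_space) chart set \<Rightarrow> ('x, 'e) chart \<Rightarrow> 'x \<Rightarrow> 'e \<Rightarrow> ('x, 'e) tangent_vector" where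
  "coord_vector A c x u =
     (\<lambda>d. if d \<in> A \<and> x \<in> chart_dom d
          then frechet_derivative (chart_map d \<circ> chart_inv c) (at (chart_map c x)) u else 0)"

text \<open>
  A bundle endomorphism is smooth if its matrix with respect to the coordinate frame of every
  chart is.
\<close>

definition smooth_bundle_endomorphism ::
    "('x, 'e::euclidean_space) chart set \<Rightarrow>
     ('x \<Rightarrow> ('x, 'e) tangent_vector \<Rightarrow> ('x, 'e) tangent_vector) \<Rightarrow> bool" where
  "smooth_bundle_endomorphism A J \<longleftrightarrow>
     (\<forall>x. J x ` tangent_space A x \<subseteq> tangent_space A x) \<and>
     (\<forall>x. \<forall>v\<in>tangent_space A x. \<forall>w\<in>tangent_space A x. \<forall>a b.
        J x (\<lambda>c. a *\<^sub>R v c + b *\<^sub>R w c) = (\<lambda>c. a *\<^sub>R J x v c + b *\<^sub>R J x w c)) \<and>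
     (\<forall>c\<in>A. \<forall>u. C_infinity_on (chart_map c ` chart_dom c)
        (\<lambda>y. J (chart_inv c y) (coord_vector A c (chart_inv c y) u) c))"

definition almost_complex_manifold ::
    "('x::{t2_space,second_countable_topology}, 'e::euclidean_space) chart set \<Rightarrow>
     ('x \<Rightarrow> ('x, 'e) tangent_vector \<Rightarrow> ('x, 'e) tangent_vector) \<Rightarrow> bool" where
  "almost_complex_manifold A J \<longleftrightarrow>
     smooth_atlas A \<and> smooth_bundle_endomorphism A J \<and>
     (\<forall>x. \<forall>v\<in>tangent_space A x. J x (J x v) = (\<lambda>c. - v c))"

definition C_k_function ::
    "nat \<Rightarrow> ('x, 'e::euclidean_space) chart set \<Rightarrow> 'x set \<Rightarrow> ('x \<Rightarrow> real) \<Rightarrow> bool" where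
  "C_k_function k A \<Omega> f \<longleftrightarrow>
     (\<forall>c\<in>A. C_k_on k (chart_map c ` (chart_dom c \<inter> \<Omega>)) (f \<circ> chart_inv c))"

text \<open>
  The differential of a function and the exterior derivative of a 1-form do not depend on the
  chart in which they are computed.
\<close>

definition some_chart :: "('x, 'e) chart set \<Rightarrow> 'x \<Rightarrow> ('x, 'e) chart" where
  "some_chart A x = (SOME c. c \<in> A \<and> x \<in> chart_dom c)"

definition differential ::
    "('x, 'e::euclidean_space) chart set \<Rightarrow> ('x \<Rightarrow> real) \<Rightarrow> 'x \<Rightarrow> ('x, 'e) tangent_vector \<Rightarrow> real" where
  "differential A f x v =
     (let c = some_chart A x
      in frechet_derivative (f \<circ> chart_inv c) (at (chart_map c x)) (v c))"

text \<open>
  Convention: \<open>d\<alpha>(V,W) = V(\<alpha>(W)) - W(\<alpha>(V)) - \<alpha>([V,W])\<close>, evaluated on the vector fields with constant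
  coordinates in the chart.
\<close>

definition exterior_derivative ::
    "('x, 'e::euclidean_space) chart set \<Rightarrow> ('x \<Rightarrow> ('x, 'e) tangent_vector \<Rightarrow> real) \<Rightarrow>
     'x \<Rightarrow> ('x, 'e) tangent_vector \<Rightarrow> ('x, 'e) tangent_vector \<Rightarrow> real" where
  "exterior_derivative A \<alpha> x v w =
     (let c = some_chart A x;
          a = (\<lambda>u y. \<alpha> (chart_inv c y) (coord_vector A c (chart_inv c y) u))
      in frechet_derivative (a (w c)) (at (chart_map c x)) (v c)
         - frechet_derivative (a (v c)) (at (chart_map c x)) (w c))"

definition d_c ::
    "('x, 'e::euclidean_space) chart set \<Rightarrow>
     ('x \<Rightarrow> ('x, 'e) tangent_vector \<Rightarrow> ('x, 'e) tangent_vector) \<Rightarrow>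
     ('x \<Rightarrow> real) \<Rightarrow> 'x \<Rightarrow> ('x, 'e) tangent_vector \<Rightarrow> real" where
  "d_c A J \<phi> x v = - differential A \<phi> x (J x v)"

definition strictly_plurisubharmonic_on ::
    "('x, 'e::euclidean_space) chart set \<Rightarrow>
     ('x \<Rightarrow> ('x, 'e) tangent_vector \<Rightarrow> ('x, 'e) tangent_vector) \<Rightarrow>
     'x set \<Rightarrow> ('x \<Rightarrow> real) \<Rightarrow> bool" where
  "strictly_plurisubharmonic_on A J \<Omega> \<phi> \<longleftrightarrow>
     (\<forall>x\<in>\<Omega>. \<forall>v\<in>tangent_space A x. v \<noteq> (\<lambda>c. 0) \<longrightarrow>
        exterior_derivative A (d_c A J \<phi>) x v (J x v) > 0)"

definition exhaustion_function :: "'x::topological_space set \<Rightarrow> ('x \<Rightarrow> real) \<Rightarrow> bool" where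
  "exhaustion_function \<Omega> \<phi> \<longleftrightarrow> (\<forall>r. compact {x \<in> \<Omega>. \<phi> x \<le> r})"

definition relatively_compact_domain :: "'x::topological_space set \<Rightarrow> bool" where
  "relatively_compact_domain \<Omega> \<longleftrightarrow>
     \<Omega> \<noteq> {} \<and> connected \<Omega> \<and> open \<Omega> \<and> compact (closure \<Omega>)"

end

theory Submission
  imports Defs
begin

text \<open>
  At a critical point \<open>x\<close> of \<open>\<phi>\<close> strict plurisubharmonicity reads
  \<open>Hess(v, v) + Hess(Jv, Jv) > 0\<close>, so in real dimension at least \<open>4\<close> the Hessian is positive
  definite on a plane. A function that is convex along a family of parallel planar discs and larger
  than \<open>\<phi> x\<close> over their boundary circles has a connected superlevel set \<open>{\<phi> > \<phi> x}\<close> near \<open>x\<close>, since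
  the complement of a convex subset of a disc retracts to the circle; at regular points the same
  holds with segments in place of discs. Hence arbitrarily small neighbourhoods of every point
  meet the superlevel set in a non-empty connected set, and no Morse theory is needed.

  If \<open>{\<phi> > c0}\<close> split into two disjoint non-empty open sets, the splitting would extend to
  \<open>{\<phi> > c}\<close> for smaller and smaller \<open>c\<close>: the extension is unique since \<open>\<phi>\<close> has no local maximum, so
  extensions can be glued in the limit, and since the two sides have no common closure point on
  the level \<open>c\<close>, they can be pushed below it. This contradicts the connectedness of \<open>\<Omega>\<close>. So all
  superlevel sets are connected, while disjoint neighbourhoods of two parts of the frontier would
  disconnect a high one.
\<close>

subsection \<open>Superlevel sets of exhaustion functions\<close>

lemma separation_disjoint_compact:
  fixes S T :: "'a::t2_space set"
  assumes "compact S" "compact T" "S \<inter> T = {}"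
  obtains U V where "open U" "open V" "S \<subseteq> U" "T \<subseteq> V" "U \<inter> V = {}"
proof -
  have "Hausdorff_space (euclidean :: 'a topology)"
    unfolding Hausdorff_space_def using hausdorff by (simp add: disjnt_def) blast
  then have "\<exists>U V. openin euclidean U \<and> openin euclidean V \<and> S \<subseteq> U \<and> T \<subseteq> V \<and> disjnt U V"
    using assms unfolding Hausdorff_space_compact_sets
    by (auto simp: disjnt_def)
  then show ?thesis using that by (auto simp: disjnt_def)
qed

text \<open>\<open>local_superlevel\<close> is all that the topological argument keeps of
  plurisubharmonicity. Non-emptiness of the local superlevel set rules out local maxima; its
  connectedness prevents the two sides of a separation from touching at the edge of a superlevel
  set.\<close>

locale exhausted_domain =
  fixes \<Omega> :: "'x::t2_space set" and \<phi> :: "'x \<Rightarrow> real"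
  assumes domain: "relatively_compact_domain \<Omega>"
    and exhaustion: "exhaustion_function \<Omega> \<phi>"
    and continuous: "continuous_on \<Omega> \<phi>"
    and local_superlevel: "\<And>x U. x \<in> \<Omega> \<Longrightarrow> open U \<Longrightarrow> x \<in> U \<Longrightarrow>
      \<exists>W. open W \<and> x \<in> W \<and> W \<subseteq> U \<and>
        connected {y \<in> W \<inter> \<Omega>. \<phi> y > \<phi> x} \<and> {y \<in> W \<inter> \<Omega>. \<phi> y > \<phi> x} \<noteq> {}"
begin

definition superlevel :: "real \<Rightarrow> 'x set" where
  "superlevel c = {x \<in> \<Omega>. \<phi> x > c}"

definition sublevel :: "real \<Rightarrow> 'x set" where
  "sublevel c = {x \<in> \<Omega>. \<phi> x \<le> c}"

lemma open_domain: "open \<Omega>" and connected_domain: "connected \<Omega>"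
  and compact_closure_domain: "compact (closure \<Omega>)" and nonempty_domain: "\<Omega> \<noteq> {}"
  using domain by (auto simp: relatively_compact_domain_def)

lemma compact_sublevel: "compact (sublevel c)"
  using exhaustion by (simp add: exhaustion_function_def sublevel_def)

lemma open_superlevel: "open (superlevel c)"
proof -
  have "superlevel c = \<Omega> - sublevel c"
    by (auto simp: superlevel_def sublevel_def)
  then show ?thesis
    using open_domain compact_sublevel compact_imp_closed by auto
qed

lemma not_local_max:
  assumes "x \<in> \<Omega>" "open U" "x \<in> U"
  obtains y where "y \<in> U \<inter> \<Omega>" "\<phi> y > \<phi> x"
  using local_superlevel[OF assms] by blast

lemma attains_max:
  assumes "compact K" "K \<noteq> {}" "K \<subseteq> \<Omega>"
  obtains z where "z \<in> K" "\<And>y. y \<in> K \<Longrightarrow> \<phi> y \<le> \<phi> z"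
  using continuous_attains_sup[OF assms(1,2)] continuous_on_subset[OF continuous assms(3)] by blast

text \<open>A neighbourhood avoiding the superlevel set would make \<open>x\<close> a local maximum.
  It guarantees that every point on the level \<open>c\<close> is a limit of one of the two sides of
  a separation of \<open>superlevel c\<close>.\<close>

lemma level_subset_closure:
  assumes "x \<in> \<Omega>" shows "x \<in> closure (superlevel (\<phi> x))"
proof (rule ccontr)
  assume "x \<notin> closure (superlevel (\<phi> x))"
  then obtain y where "y \<in> - closure (superlevel (\<phi> x)) \<inter> \<Omega>" "\<phi> y > \<phi> x"
    using not_local_max[OF assms, of "- closure (superlevel (\<phi> x))"] by blast
  then show False using closure_subset[of "superlevel (\<phi> x)"] by (auto simp: superlevel_def)
qed

section \<open>Extending a separation to lower superlevel sets\<close>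

text \<open>For \<open>c \<le> c0\<close>, the pair \<open>V\<close>, \<open>W\<close> continues a
  fixed separation \<open>A\<close>, \<open>B\<close> of \<open>superlevel c0\<close> to the larger
  set \<open>superlevel c\<close>. Prescribing the traces on \<open>superlevel c0\<close> is what
  makes the continuation unique.\<close>

definition splitting :: "real \<Rightarrow> 'x set \<Rightarrow> 'x set \<Rightarrow> real \<Rightarrow> 'x set \<Rightarrow> 'x set \<Rightarrow> bool" where
  "splitting c0 A B c V W \<longleftrightarrow> open V \<and> open W \<and> V \<inter> W = {} \<and> V \<union> W = superlevel c \<and>
     V \<inter> superlevel c0 = A \<and> W \<inter> superlevel c0 = B"

lemma splitting_swap: "splitting c0 A B c V W \<Longrightarrow> splitting c0 B A c W V"
  by (auto simp: splitting_def)

text \<open>Uniqueness by a maximum principle: the overlap \<open>V \<inter> W'\<close> stays below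
  the level \<open>c0\<close>, so \<phi> attains a maximum on its compact closure. The maximum point
  has value above \<open>c'\<close> and lies in the overlap itself, which is open, so it would be a
  local maximum of \<phi>.\<close>

lemma splitting_disjoint:
  assumes 1: "splitting c0 A B c V W" and 2: "splitting c0 A B c' V' W'" and "c \<le> c'" "c' \<le> c0"
  shows "V \<inter> W' = {}"
proof (rule ccontr)
  define Z where "Z = V \<inter> W'"
  assume "V \<inter> W' \<noteq> {}"
  then obtain z0 where z0: "z0 \<in> Z" by (auto simp: Z_def)
  have opZ: "open Z" using 1 2 by (auto simp: splitting_def Z_def)
  have Zsup: "Z \<subseteq> superlevel c'" using 2 by (auto simp: splitting_def Z_def)
  \<comment> \<open>Above \<open>c0\<close> the sets \<open>V\<close> and \<open>W'\<close> reduce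
    to \<open>A\<close> and \<open>B\<close>, which are disjoint because they are also traces of the
    disjoint sets \<open>V\<close> and \<open>W\<close>.\<close>
  have "Z \<inter> superlevel c0 = {}"
    using 1 2 by (auto simp: splitting_def Z_def)
  then have Zsub: "Z \<subseteq> sublevel c0"
    using Zsup by (auto simp: superlevel_def sublevel_def)
  have "closed (sublevel c0)" by (simp add: compact_sublevel compact_imp_closed)
  then have clZ: "closure Z \<subseteq> sublevel c0"
    using Zsub closure_minimal by blast
  then have "compact (closure Z)"
    using compact_Int_closed[OF compact_sublevel[of c0] closed_closure[of Z]]
    by (simp add: inf.absorb2)
  moreover have "closure Z \<noteq> {}" using z0 closure_subset by blast
  moreover have "closure Z \<subseteq> \<Omega>" using clZ by (auto simp: sublevel_def)
  ultimately obtain z where z: "z \<in> closure Z" "\<And>y. y \<in> closure Z \<Longrightarrow> \<phi> y \<le> \<phi> z"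
    using attains_max by metis
  have zO: "z \<in> \<Omega>" using z clZ by (auto simp: sublevel_def)
  have "\<phi> z0 \<le> \<phi> z" "\<phi> z0 > c'"
    using z0 z closure_subset Zsup by (auto simp: superlevel_def)
  then have zs: "z \<in> superlevel c'" using zO by (auto simp: superlevel_def)
  \<comment> \<open>This open set is the complement of \<open>Z\<close> inside
    \<open>superlevel c'\<close>. So \<open>Z\<close> is relatively closed there and contains its
    closure point \<open>z\<close>.\<close>
  have "open ((superlevel c' \<inter> W) \<union> V')"
    using 1 2 open_superlevel by (auto simp: splitting_def)
  moreover have "Z \<inter> ((superlevel c' \<inter> W) \<union> V') = {}"
    using 1 2 by (auto simp: splitting_def Z_def)
  ultimately have "closure Z \<inter> ((superlevel c' \<inter> W) \<union> V') = {}"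
    using open_Int_closure_eq_empty[of "(superlevel c' \<inter> W) \<union> V'" Z] by (metis inf_commute)
  moreover have "superlevel c' \<subseteq> superlevel c" using assms by (auto simp: superlevel_def)
  ultimately have "z \<in> Z"
    using zs z(1) 1 2 by (auto simp: splitting_def Z_def)
  then obtain y where "y \<in> Z \<inter> \<Omega>" "\<phi> y > \<phi> z"
    using not_local_max[OF zO opZ] by blast
  then show False using z(2)[of y] closure_subset[of Z] by auto
qed

lemma splitting_disjoint':
  assumes "splitting c0 A B c V W" "splitting c0 A B c' V' W'" "c \<le> c0" "c' \<le> c0"
  shows "V \<inter> W' = {}"
proof (cases "c \<le> c'")
  case True
  then show ?thesis using splitting_disjoint assms by blast
next
  case False
  then show ?thesis
    using splitting_disjoint[OF splitting_swap[OF assms(2)] splitting_swap[OF assms(1)]] assms by auto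
qed

text \<open>\<open>superlevel c\<close> is the increasing union of the sets
  \<open>superlevel d\<close> with \<open>d > c\<close>. Splittings chosen independently at these
  levels can be united because uniqueness makes them compatible.\<close>

lemma splitting_at_limit:
  assumes "c < c0" and
    split: "\<And>d. c < d \<Longrightarrow> d \<le> c0 \<Longrightarrow> \<exists>V W. splitting c0 A B d V W"
  shows "\<exists>V W. splitting c0 A B c V W"
proof -
  obtain V W where VW: "\<And>d. c < d \<Longrightarrow> d \<le> c0 \<Longrightarrow> splitting c0 A B d (V d) (W d)"
    using split by metis
  have "(\<Union>d\<in>{c<..c0}. V d) \<union> (\<Union>d\<in>{c<..c0}. W d) = (\<Union>d\<in>{c<..c0}. superlevel d)"
    using VW by (fastforce simp: splitting_def)
  also have "\<dots> = superlevel c"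
  proof -
    have "\<exists>d\<in>{c<..c0}. x \<in> superlevel d" if "x \<in> superlevel c" for x
    proof -
      have "c < min c0 (\<phi> x)" using that assms by (auto simp: superlevel_def)
      then obtain d where "c < d" "d < min c0 (\<phi> x)" using dense by blast
      then show ?thesis using that by (intro bexI[of _ d]) (auto simp: superlevel_def)
    qed
    then show ?thesis by (auto simp: superlevel_def)
  qed
  finally have 1: "(\<Union>d\<in>{c<..c0}. V d) \<union> (\<Union>d\<in>{c<..c0}. W d) = superlevel c" .
  \<comment> \<open>Disjointness is required for sides taken from two different levels, which is
    exactly what \<open>splitting_disjoint'\<close> provides.\<close>
  have 2: "(\<Union>d\<in>{c<..c0}. V d) \<inter> (\<Union>d\<in>{c<..c0}. W d) = {}"
    using splitting_disjoint' VW by fastforce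
  have 3: "c0 \<in> {c<..c0}" using assms by auto
  have 4: "V d \<inter> superlevel c0 = A" "W d \<inter> superlevel c0 = B" "open (V d)" "open (W d)"
    if "d \<in> {c<..c0}" for d
    using VW that by (auto simp: splitting_def)
  have "splitting c0 A B c (\<Union>d\<in>{c<..c0}. V d) (\<Union>d\<in>{c<..c0}. W d)"
    unfolding splitting_def
  proof (intro conjI)
    show "(\<Union>d\<in>{c<..c0}. V d) \<inter> superlevel c0 = A" "(\<Union>d\<in>{c<..c0}. W d) \<inter> superlevel c0 = B"
      using 3 4(1,2) by blast+
  qed (use 1 2 4 in auto)
  then show ?thesis by blast
qed

text \<open>The closures of \<open>V\<close> and \<open>W\<close> do not meet in \<Omega>: a common
  point would lie on the level \<open>c\<close>, where a small connected piece of the superlevel set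
  would meet both sides. Disjoint neighbourhoods of the closures then cover the level
  \<open>c\<close> and, by compactness, everything down to some lower level
  \<open>d\<close>.\<close>

lemma splitting_below:
  assumes VW: "splitting c0 A B c V W" and "c \<le> c0"
  shows "\<exists>d<c. \<exists>V' W'. splitting c0 A B d V' W'"
proof -
  have disj: "closure V \<inter> closure W \<inter> \<Omega> = {}"
  proof (rule ccontr)
    assume "closure V \<inter> closure W \<inter> \<Omega> \<noteq> {}"
    then obtain x where x: "x \<in> closure V" "x \<in> closure W" "x \<in> \<Omega>" by blast
    have "W \<inter> closure V = {}" "V \<inter> closure W = {}"
      using VW open_Int_closure_eq_empty[of W V] open_Int_closure_eq_empty[of V W]
      by (auto simp: splitting_def)
    then have "x \<notin> superlevel c" using x VW by (auto simp: splitting_def)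
    then have le: "\<phi> x \<le> c" using x by (auto simp: superlevel_def)
    have "\<phi> x = c"
    proof (rule ccontr)
      assume "\<phi> x \<noteq> c"
      then have "\<phi> x < c" using le by simp
      let ?U = "\<Omega> \<inter> \<phi> -` {..<c}"
      have "open ?U" by (rule continuous_open_preimage[OF continuous open_domain open_lessThan])
      moreover have "x \<in> ?U" using \<open>\<phi> x < c\<close> x by auto
      moreover have "V \<subseteq> superlevel c" using VW by (auto simp: splitting_def)
      then have "?U \<inter> V = {}" by (auto simp: superlevel_def)
      ultimately show False using x open_Int_closure_eq_empty by blast
    qed
    obtain N where N: "open N" "x \<in> N" "connected {y \<in> N \<inter> \<Omega>. \<phi> y > c}"
      using local_superlevel[OF x(3) open_UNIV] \<open>\<phi> x = c\<close> by auto
    have eq: "{y \<in> N \<inter> \<Omega>. \<phi> y > c} = N \<inter> (V \<union> W)"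
      using VW by (auto simp: splitting_def superlevel_def)
    have "N \<inter> V \<noteq> {}" "N \<inter> W \<noteq> {}"
      using N x open_Int_closure_eq_empty by blast+
    then show False
      using connectedD[OF N(3)[unfolded eq], of V W] VW by (auto simp: splitting_def)
  qed
  \<comment> \<open>\<open>V\<close> and \<open>W\<close> may accumulate at the frontier of
    \<Omega>; cutting off by a compact sublevel set leaves compact pieces inside \<Omega>, which can
    be separated.\<close>
  let ?S = "closure V \<inter> sublevel c0" and ?T = "closure W \<inter> sublevel c0"
  have "compact ?S" "compact ?T"
    using compact_Int_closed[OF compact_sublevel] closed_closure by (metis inf_commute)+
  moreover have "?S \<inter> ?T = {}" using disj by (auto simp: sublevel_def)
  ultimately obtain P Q where PQ: "open P" "open Q" "?S \<subseteq> P" "?T \<subseteq> Q" "P \<inter> Q = {}"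
    by (rule separation_disjoint_compact)
  define K where "K = sublevel c - (P \<union> Q)"
  have "compact K" unfolding K_def
    using compact_sublevel PQ by (intro compact_diff) auto
  \<comment> \<open>Points on the level \<open>c\<close> are limits of \<open>V \<union> W\<close>
    and hence covered by \<open>P\<close> or \<open>Q\<close>. On the compact remainder
    \<open>K\<close> the function is therefore strictly below \<open>c\<close>, and its maximum
    there can serve as \<open>d\<close>.\<close>
  have lt: "\<phi> x < c" if "x \<in> K" for x
  proof (rule ccontr)
    assume "\<not> \<phi> x < c"
    then have x: "\<phi> x = c" "x \<in> \<Omega>" "x \<notin> P" "x \<notin> Q" using that by (auto simp: K_def sublevel_def)
    then have "x \<in> closure (superlevel c)" using level_subset_closure by blast
    then have "x \<in> closure V \<union> closure W" using VW by (simp add: splitting_def flip: closure_Un)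
    moreover have "x \<in> sublevel c0" using x assms by (auto simp: sublevel_def)
    ultimately show False using PQ x by auto
  qed
  obtain d where d: "d < c" "\<And>x. x \<in> K \<Longrightarrow> \<phi> x \<le> d"
  proof (cases "K = {}")
    case True
    then show ?thesis using that[of "c - 1"] by auto
  next
    case False
    moreover have "K \<subseteq> \<Omega>" by (auto simp: K_def sublevel_def)
    ultimately obtain z where "z \<in> K" "\<And>y. y \<in> K \<Longrightarrow> \<phi> y \<le> \<phi> z"
      using attains_max[OF \<open>compact K\<close>] by blast
    then show ?thesis using that[of "\<phi> z"] lt by auto
  qed
  \<comment> \<open>Subtracting the closure of the opposite side keeps \<open>V'\<close> and
    \<open>W'\<close> disjoint and adds no point of \<open>superlevel c0\<close>, which is already
    covered by \<open>V \<union> W\<close>.\<close>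
  define V' where "V' = V \<union> (superlevel d \<inter> P - closure W)"
  define W' where "W' = W \<union> (superlevel d \<inter> Q - closure V)"
  have "open V'" "open W'" unfolding V'_def W'_def
    using VW PQ by (auto simp: splitting_def intro!: open_Un open_Diff open_Int open_superlevel)
  moreover have "V' \<inter> W' = {}"
    using VW PQ closure_subset[of V] closure_subset[of W]
    by (auto simp: V'_def W'_def splitting_def)
  moreover have "superlevel c \<subseteq> superlevel d" using \<open>d < c\<close> by (auto simp: superlevel_def)
  then have "V' \<union> W' \<subseteq> superlevel d" using VW by (auto simp: V'_def W'_def splitting_def)
  then have "V' \<union> W' = superlevel d"
  proof (rule subset_antisym)
    show "superlevel d \<subseteq> V' \<union> W'"
    proof
      fix x assume x: "x \<in> superlevel d"
      show "x \<in> V' \<union> W'"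
      proof (cases "\<phi> x > c")
        case True
        then have "x \<in> superlevel c" using x by (simp add: superlevel_def)
        then show ?thesis using VW by (auto simp: V'_def W'_def splitting_def)
      next
        \<comment> \<open>The subtraction loses nothing here: within \<open>sublevel c0\<close> the
          closure of \<open>W\<close> lies in \<open>Q\<close>, away from \<open>P\<close>, and the
          closure of \<open>V\<close> lies in \<open>P\<close>, away from \<open>Q\<close>.\<close>
        case False
        then have "x \<in> sublevel c" "x \<in> sublevel c0"
          using x assms by (auto simp: superlevel_def sublevel_def)
        moreover have "x \<notin> K" using d(2)[of x] x by (auto simp: superlevel_def)
        ultimately show ?thesis using x PQ by (auto simp: V'_def W'_def K_def)
      qed
    qed
  qed
  moreover have "superlevel c0 \<subseteq> V \<union> W"
    using VW assms by (auto simp: splitting_def superlevel_def)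
  then have "V' \<inter> superlevel c0 = V \<inter> superlevel c0" "W' \<inter> superlevel c0 = W \<inter> superlevel c0"
    using closure_subset[of V] closure_subset[of W] by (auto simp: V'_def W'_def)
  then have "V' \<inter> superlevel c0 = A" "W' \<inter> superlevel c0 = B"
    using VW by (auto simp: splitting_def)
  ultimately have "splitting c0 A B d V' W'" by (auto simp: splitting_def)
  then show ?thesis using d by blast
qed

text \<open>Downward continuous induction on the level. The levels to which a given separation
  extends are bounded below, since below the minimum of \<phi> it would disconnect \<Omega>. Their
  infimum is attained by the limit step, yet the separation can be pushed further down.\<close>

lemma connected_superlevel: "connected (superlevel c0)"
proof (rule ccontr)
  assume "\<not> connected (superlevel c0)"
  then obtain A B where AB: "open A" "open B" "A \<inter> B \<inter> superlevel c0 = {}"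
      "A \<inter> superlevel c0 \<noteq> {}" "B \<inter> superlevel c0 \<noteq> {}" "superlevel c0 \<subseteq> A \<union> B"
    unfolding connected_def by blast
  let ?A = "A \<inter> superlevel c0" and ?B = "B \<inter> superlevel c0"
  have base: "splitting c0 ?A ?B c0 ?A ?B"
    using AB open_superlevel by (auto simp: splitting_def)
  define S where "S = {c. c \<le> c0 \<and> (\<exists>V W. splitting c0 ?A ?B c V W)}"
  have "c0 \<in> S" using base by (auto simp: S_def)
  have up: "d \<in> S" if "c \<in> S" "c \<le> d" "d \<le> c0" for c d
  proof -
    obtain V W where "splitting c0 ?A ?B c V W" using \<open>c \<in> S\<close> by (auto simp: S_def)
    then have "splitting c0 ?A ?B d (V \<inter> superlevel d) (W \<inter> superlevel d)"
      using that open_superlevel by (auto simp: splitting_def superlevel_def)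
    then show ?thesis using that by (auto simp: S_def)
  qed
  \<comment> \<open>If every value of \<phi> exceeded \<open>c\<close>, then \<open>V\<close> and
    \<open>W\<close> would separate \<Omega>; both are non-empty because they contain
    \<open>?A\<close> and \<open>?B\<close>.\<close>
  have nb: "\<exists>x\<in>\<Omega>. \<phi> x \<le> c" if "c \<in> S" for c
  proof (rule ccontr)
    assume "\<not> ?thesis"
    then have "superlevel c = \<Omega>" by (force simp: superlevel_def)
    moreover obtain V W where "splitting c0 ?A ?B c V W" using \<open>c \<in> S\<close> by (auto simp: S_def)
    ultimately show False
      using connectedD[OF connected_domain, of V W] AB by (auto simp: splitting_def)
  qed
  obtain m where m: "\<And>x. x \<in> \<Omega> \<Longrightarrow> m \<le> \<phi> x"
  proof -
    obtain x0 where x0: "x0 \<in> \<Omega>" using nonempty_domain by blast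
    have "continuous_on (sublevel (\<phi> x0)) \<phi>"
      using continuous by (rule continuous_on_subset) (auto simp: sublevel_def)
    moreover have "x0 \<in> sublevel (\<phi> x0)" using x0 by (auto simp: sublevel_def)
    ultimately obtain z where "\<And>y. y \<in> sublevel (\<phi> x0) \<Longrightarrow> \<phi> z \<le> \<phi> y" "z \<in> sublevel (\<phi> x0)"
      using continuous_attains_inf[OF compact_sublevel] by blast
    then have "\<phi> z \<le> \<phi> x0" "\<And>y. y \<in> \<Omega> \<Longrightarrow> \<phi> y \<le> \<phi> x0 \<Longrightarrow> \<phi> z \<le> \<phi> y"
      using x0 by (auto simp: sublevel_def)
    then have "\<phi> z \<le> \<phi> y" if "y \<in> \<Omega>" for y
      using that by (cases "\<phi> y \<le> \<phi> x0") auto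
    then show ?thesis using that by blast
  qed
  have bdd: "bdd_below S"
    by (rule bdd_belowI[of _ m]) (meson m nb order_trans)
  have "Inf S \<le> c0" using \<open>c0 \<in> S\<close> bdd cInf_lower by blast
  have above: "d \<in> S" if "Inf S < d" "d \<le> c0" for d
  proof -
    obtain c where "c \<in> S" "c < d"
      using cInf_lessD[of S d] \<open>Inf S < d\<close> \<open>c0 \<in> S\<close> by auto
    then show ?thesis using up that by simp
  qed
  have "Inf S \<in> S"
  proof (cases "Inf S = c0")
    case False
    have "\<exists>V W. splitting c0 ?A ?B d V W" if "Inf S < d" "d \<le> c0" for d
      using above[OF that] unfolding S_def by blast
    then have "\<exists>V W. splitting c0 ?A ?B (Inf S) V W"
      using splitting_at_limit[of "Inf S" c0 ?A ?B] False \<open>Inf S \<le> c0\<close> by fastforce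
    then show ?thesis using \<open>Inf S \<le> c0\<close> unfolding S_def by blast
  qed (use \<open>c0 \<in> S\<close> in simp)
  then obtain V W where "splitting c0 ?A ?B (Inf S) V W" unfolding S_def by blast
  then obtain d V' W' where "d < Inf S" "splitting c0 ?A ?B d V' W'"
    using splitting_below[OF _ \<open>Inf S \<le> c0\<close>] by blast
  then have "d \<in> S" using \<open>Inf S \<le> c0\<close> unfolding S_def by auto
  then show False using cInf_lower[OF _ bdd, of d] \<open>d < Inf S\<close> by simp
qed

section \<open>From superlevel sets to the frontier\<close>

text \<open>Disjoint neighbourhoods \<open>P\<close>, \<open>Q\<close> of two parts of the frontier
  leave only a compact subset \<open>K\<close> of \<Omega> uncovered. Above the maximum of \<phi> on
  \<open>K\<close> the superlevel set lies in \<open>P \<union> Q\<close> and meets both.\<close>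

lemma connected_frontier: "connected (frontier \<Omega>)"
proof (rule ccontr)
  assume "\<not> connected (frontier \<Omega>)"
  then obtain F G where FG: "closed F" "closed G" "frontier \<Omega> \<subseteq> F \<union> G" "F \<inter> G \<inter> frontier \<Omega> = {}"
      "F \<inter> frontier \<Omega> \<noteq> {}" "G \<inter> frontier \<Omega> \<noteq> {}"
    unfolding connected_closed by blast
  have "compact (frontier \<Omega>)"
    using compact_closure_domain by (simp add: frontier_def compact_diff)
  then have "compact (F \<inter> frontier \<Omega>)" "compact (G \<inter> frontier \<Omega>)"
    using FG by (simp_all add: closed_Int_compact)
  moreover have "(F \<inter> frontier \<Omega>) \<inter> (G \<inter> frontier \<Omega>) = {}" using FG by blast
  ultimately obtain P Q where PQ: "open P" "open Q" "F \<inter> frontier \<Omega> \<subseteq> P" "G \<inter> frontier \<Omega> \<subseteq> Q"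
      "P \<inter> Q = {}" by (rule separation_disjoint_compact)
  define K where "K = closure \<Omega> - (P \<union> Q)"
  have "compact K" using compact_closure_domain PQ by (simp add: K_def compact_diff open_Un)
  have "frontier \<Omega> \<subseteq> P \<union> Q" using PQ FG by blast
  then have "K \<subseteq> \<Omega>" using open_domain by (auto simp: K_def frontier_def interior_open)
  obtain c where c: "\<And>x. x \<in> K \<Longrightarrow> \<phi> x \<le> c"
    using attains_max[OF \<open>compact K\<close> _ \<open>K \<subseteq> \<Omega>\<close>] by (metis empty_iff)
  have sup: "superlevel c \<subseteq> P \<union> Q"
    using c closure_subset[of \<Omega>] by (fastforce simp: superlevel_def K_def)
  \<comment> \<open>A frontier point lies outside the open set \<Omega>, hence outside the closed
    set \<open>sublevel c\<close>. So the points of \<Omega> close to it have values above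
    \<open>c\<close>.\<close>
  have meets: "N \<inter> superlevel c \<noteq> {}" if "open N" "x \<in> N" "x \<in> frontier \<Omega>" for N x
  proof -
    have "x \<in> closure \<Omega>" "x \<notin> \<Omega>" using that open_domain by (auto simp: frontier_def interior_open)
    then have "x \<in> N - sublevel c" using that by (auto simp: sublevel_def)
    moreover have "open (N - sublevel c)" using that compact_sublevel compact_imp_closed by auto
    ultimately have "(N - sublevel c) \<inter> \<Omega> \<noteq> {}"
      using \<open>x \<in> closure \<Omega>\<close> open_Int_closure_eq_empty by blast
    then show ?thesis by (auto simp: superlevel_def sublevel_def)
  qed
  have "P \<inter> superlevel c \<noteq> {}" "Q \<inter> superlevel c \<noteq> {}"
    using meets PQ FG(5,6) by blast+
  then show False
    using connectedD[OF connected_superlevel PQ(1,2) _ sup] PQ(5) by blast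
qed

end

subsection \<open>Local superlevel sets in Euclidean space\<close>

text \<open>Each point is linked to a common connected core \<open>C\<close>; the sets
  \<open>C \<union> D z\<close> are connected and all share a point of the core.\<close>

lemma connected_of_core:
  assumes "connected C" "C \<subseteq> S"
    and "\<And>z. z \<in> S \<Longrightarrow> \<exists>D. connected D \<and> D \<subseteq> S \<and> z \<in> D \<and> D \<inter> C \<noteq> {}"
  shows "connected S"
proof (cases "S = {}")
  case False
  obtain D where D: "\<And>z. z \<in> S \<Longrightarrow> connected (D z) \<and> D z \<subseteq> S \<and> z \<in> D z \<and> D z \<inter> C \<noteq> {}"
    using assms(3) by metis
  obtain c where "c \<in> C" using False D by blast
  have "connected (\<Union>z\<in>S. C \<union> D z)"
  proof (rule connected_Union)
    show "connected U" if "U \<in> (\<lambda>z. C \<union> D z) ` S" for U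
      using that D assms(1) connected_Un by blast
    show "\<Inter> ((\<lambda>z. C \<union> D z) ` S) \<noteq> {}" using \<open>c \<in> C\<close> by blast
  qed
  moreover have "(\<Union>z\<in>S. C \<union> D z) = S" using D assms(2) False by blast
  ultimately show ?thesis by simp
qed simp

text \<open>The neighbourhood is a union of small translates of \<open>p + T K\<close>; on every translate the
  superlevel set is joined to the part over \<open>B\<close>.\<close>

lemma local_superlevel_of_family:
  fixes f :: "'e::real_normed_vector \<Rightarrow> real" and T :: "'b::metric_space \<Rightarrow> 'e"
  assumes K: "compact K" "a \<in> K" and T: "continuous_on K T" "T a = 0"
    and B: "B \<subseteq> K" "compact B" "connected B" "B \<noteq> {}"
    and N: "open N" "continuous_on N f"
    and KN: "\<And>s. s \<in> K \<Longrightarrow> p + T s \<in> N"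
    and Bf: "\<And>s. s \<in> B \<Longrightarrow> f (p + T s) > c"
    and path: "\<And>q s. \<lbrakk>\<And>s. s \<in> K \<Longrightarrow> q + T s \<in> N; \<And>s. s \<in> B \<Longrightarrow> f (q + T s) > c;
        s \<in> K; f (q + T s) > c\<rbrakk> \<Longrightarrow>
        \<exists>D. connected D \<and> s \<in> D \<and> D \<subseteq> K \<and> D \<inter> B \<noteq> {} \<and> (\<forall>d\<in>D. f (q + T d) > c)"
  shows "\<exists>W. open W \<and> p \<in> W \<and> W \<subseteq> N \<and> connected {y\<in>W. f y > c} \<and> {y\<in>W. f y > c} \<noteq> {}"
proof -
  have "compact ((\<lambda>s. p + T s) ` K)"
    using K T by (intro compact_continuous_image continuous_intros)
  then obtain e1 where e1: "e1 > 0" "(\<Union>x\<in>(\<lambda>s. p + T s) ` K. ball x e1) \<subseteq> N"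
    using compact_subset_open_imp_ball_epsilon_subset[OF _ N(1)] KN by blast
  have "compact ((\<lambda>s. p + T s) ` B)"
    using B T by (intro compact_continuous_image continuous_intros) (auto intro: continuous_on_subset)
  moreover have "open (N \<inter> f -` {c<..})"
    by (rule continuous_open_preimage[OF N(2,1) open_greaterThan])
  moreover have "(\<lambda>s. p + T s) ` B \<subseteq> N \<inter> f -` {c<..}"
    using KN Bf B by auto
  ultimately obtain e2 where e2: "e2 > 0" "(\<Union>x\<in>(\<lambda>s. p + T s) ` B. ball x e2) \<subseteq> N \<inter> f -` {c<..}"
    by (rule compact_subset_open_imp_ball_epsilon_subset)
  \<comment> \<open>Translations by less than \<open>e1\<close> keep the whole family in
    \<open>N\<close>; those by less than \<open>e2\<close> preserve the inequality over
    \<open>B\<close>.\<close>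
  define e where "e = min e1 e2"
  have "e > 0" using e1 e2 by (simp add: e_def)
  have near: "dist (p + T s) (q + T s) = dist p q" for q s
    by (simp add: dist_norm)
  have qK: "q + T s \<in> N" if "q \<in> ball p e" "s \<in> K" for q s
    using that e1(2) near[of s q] by (fastforce simp: e_def)
  have qB: "f (q + T s) > c" if "q \<in> ball p e" "s \<in> B" for q s
  proof -
    have "q + T s \<in> ball (p + T s) e2" using that near[of s q] by (simp add: e_def)
    then show ?thesis using that e2(2) by blast
  qed
  define W where "W = (\<Union>q\<in>ball p e. \<Union>y\<in>T ` K. {q + y})"
  have W: "y \<in> W \<longleftrightarrow> (\<exists>q\<in>ball p e. \<exists>s\<in>K. y = q + T s)" for y
    by (auto simp: W_def)
  have "open W" unfolding W_def by (rule open_sums) simp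
  moreover have "p \<in> W" unfolding W using \<open>e > 0\<close> K T
    by (intro bexI[of _ p] bexI[of _ a]) auto
  moreover have "W \<subseteq> N" using qK by (auto simp: W)
  moreover
  \<comment> \<open>The core consists of the parts of all translates over \<open>B\<close>; it is
    the continuous image of the connected product \<open>ball p e \<times> B\<close>.\<close>
  define C where "C = (\<lambda>(q, s). q + T s) ` (ball p e \<times> B)"
  have "connected C" unfolding C_def
  proof (rule connected_continuous_image)
    have "continuous_on (ball p e \<times> B) (\<lambda>x. T (snd x))"
      by (rule continuous_on_compose2[OF T(1)]) (use B in \<open>auto intro!: continuous_intros\<close>)
    then show "continuous_on (ball p e \<times> B) (\<lambda>(q, s). q + T s)"
      unfolding case_prod_beta by (intro continuous_intros)
    show "connected (ball p e \<times> B)" using B by (simp add: connected_Times)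
  qed
  have CW: "C \<subseteq> {y\<in>W. f y > c}"
    using qB B(1) unfolding C_def by (force simp: W)
  have "connected {y\<in>W. f y > c}"
  proof (rule connected_of_core[OF \<open>connected C\<close> CW])
    fix z assume "z \<in> {y\<in>W. f y > c}"
    then obtain q s where qs: "q \<in> ball p e" "s \<in> K" "z = q + T s" "f (q + T s) > c"
      by (auto simp: W)
    obtain D where D: "connected D" "s \<in> D" "D \<subseteq> K" "D \<inter> B \<noteq> {}" "\<And>d. d \<in> D \<Longrightarrow> f (q + T d) > c"
      using path[OF qK[OF qs(1)] qB[OF qs(1)] qs(2,4)] by blast
    have "connected ((\<lambda>d. q + T d) ` D)"
      using D T by (intro connected_continuous_image continuous_intros) (auto intro: continuous_on_subset)
    moreover have "(\<lambda>d. q + T d) ` D \<subseteq> {y\<in>W. f y > c}"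
      using D(3,5) qs(1) by (force simp: W)
    moreover have "z \<in> (\<lambda>d. q + T d) ` D" using D qs by auto
    moreover have "(\<lambda>d. q + T d) ` D \<inter> C \<noteq> {}"
      using D(4) qs(1) by (fastforce simp: C_def)
    ultimately show "\<exists>D. connected D \<and> D \<subseteq> {y\<in>W. f y > c} \<and> z \<in> D \<and> D \<inter> C \<noteq> {}" by blast
  qed
  moreover have "{y\<in>W. f y > c} \<noteq> {}"
  proof -
    have "C \<noteq> {}" using B(4) \<open>e > 0\<close> by (simp add: C_def)
    then show ?thesis using CW by blast
  qed
  ultimately show ?thesis by blast
qed

section \<open>A positive definite plane from positivity on complex lines\<close>

text \<open>For each non-zero \<open>u\<close>, the form is positive at \<open>u\<close> or at
  \<open>J u\<close>. Once \<open>v\<close> is chosen, orthogonality of both \<open>x\<close> and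
  \<open>J x\<close> to \<open>v\<close>, with respect to the symmetric part of \<open>h\<close>,
  amounts to two real linear equations. In dimension above 2 they have a non-zero solution, and
  \<open>x\<close> or \<open>J x\<close> serves as \<open>w\<close>.\<close>

lemma exists_positive_plane:
  fixes h :: "'e::euclidean_space \<Rightarrow> 'e \<Rightarrow> real" and J :: "'e \<Rightarrow> 'e"
  assumes h: "bilinear h" and J: "linear J" "\<And>v. J (J v) = - v"
    and pos: "\<And>v. v \<noteq> 0 \<Longrightarrow> h v v + h (J v) (J v) > 0" and dim: "DIM('e) > 2"
  obtains v w where "h v v > 0" "h w w > 0" "h v w + h w v = 0"
proof -
  have pick: "h u u > 0 \<or> h (J u) (J u) > 0" if "u \<noteq> 0" for u
    using pos[OF that] by linarith
  obtain u :: 'e where "u \<noteq> 0" using nonempty_Basis nonzero_Basis by blast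
  then obtain v where v: "h v v > 0" using pick by blast
  \<comment> \<open>The two equations are packed into one real linear map into the complex numbers,
    whose real dimension is 2.\<close>
  define L where "L u = Complex (h v u + h u v) (h v (J u) + h (J u) v)" for u
  have "linear L"
    by (rule linearI) (simp_all add: L_def linear_add[OF J(1)] linear_scale[OF J(1)]
      bilinear_ladd[OF h] bilinear_radd[OF h] bilinear_lmul[OF h] bilinear_rmul[OF h]
      complex_eq_iff algebra_simps)
  have "\<not> inj L"
  proof
    assume "inj L"
    then have "dim (range L) = DIM('e)"
      using dim_image_eq[OF \<open>linear L\<close>, of UNIV] by simp
    then show False using dim dim_subset_UNIV[of "range L"] by simp
  qed
  then obtain x where x: "L x = 0" "x \<noteq> 0"
    using linear_injective_0[OF \<open>linear L\<close>] by blast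
  then have "h v x + h x v = 0" "h v (J x) + h (J x) v = 0"
    by (simp_all add: L_def complex_eq_iff)
  then show ?thesis using pick[OF x(2)] v that by blast
qed

section \<open>First and second derivatives\<close>

definition fderiv :: "('e::euclidean_space \<Rightarrow> real) \<Rightarrow> 'e \<Rightarrow> 'e \<Rightarrow> real" where
  "fderiv f y u = frechet_derivative f (at y) u"

text \<open>The inner direction \<open>u\<close> is held constant while differentiating along
  \<open>w\<close>, in accordance with the recursion of \<open>C_k_on\<close>.\<close>

definition hessian :: "('e::euclidean_space \<Rightarrow> real) \<Rightarrow> 'e \<Rightarrow> 'e \<Rightarrow> 'e \<Rightarrow> real" where
  "hessian f y w u = fderiv (\<lambda>y. fderiv f y u) y w"

lemma C_2_onD:
  assumes "C_k_on 2 S f" "y \<in> S"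
  shows "(f has_derivative fderiv f y) (at y)"
    and "((\<lambda>y. fderiv f y u) has_derivative (\<lambda>w. hessian f y w u)) (at y)"
  using assms unfolding fderiv_def hessian_def
  by (auto simp: numeral_2_eq_2 frechet_derivative_works)

lemma C_2_on_continuous:
  assumes "C_k_on 2 S f"
  shows "continuous_on S (\<lambda>y. fderiv f y u)" and "continuous_on S (\<lambda>y. hessian f y w u)"
    and "continuous_on S f"
proof -
  show "continuous_on S (\<lambda>y. hessian f y w u)"
    using assms unfolding fderiv_def hessian_def by (auto simp: numeral_2_eq_2)
  show "continuous_on S (\<lambda>y. fderiv f y u)" "continuous_on S f"
    by (rule has_derivative_continuous_on, rule has_derivative_at_withinI, erule C_2_onD[OF assms])+
qed

lemma linear_fderiv:
  assumes "C_k_on 2 S f" "y \<in> S" shows "linear (fderiv f y)"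
  using C_2_onD(1)[OF assms] by (rule has_derivative_linear)

text \<open>Linearity in the outer direction is that of a derivative. In the inner direction it
  follows from linearity of \<open>fderiv f y\<close> at all nearby points and uniqueness of
  derivatives.\<close>

lemma bilinear_hessian:
  assumes f: "C_k_on 2 S f" "y \<in> S" and S: "open S"
  shows "bilinear (hessian f y)"
proof -
  note lin = linear_fderiv[OF f(1)]
  have 1: "linear (\<lambda>w. hessian f y w u)" for u
    using C_2_onD(2)[OF f] by (rule has_derivative_linear)
  have 2: "hessian f y w (u + v) = hessian f y w u + hessian f y w v" for w u v
  proof -
    have "((\<lambda>y. fderiv f y u + fderiv f y v) has_derivative
        (\<lambda>w. hessian f y w u + hessian f y w v)) (at y)"
      by (intro derivative_intros C_2_onD(2)[OF f])
    then have "((\<lambda>y. fderiv f y (u + v)) has_derivative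
        (\<lambda>w. hessian f y w u + hessian f y w v)) (at y)"
      by (rule has_derivative_transform_within_open[OF _ S f(2)]) (simp add: linear_add[OF lin])
    from has_derivative_unique[OF this C_2_onD(2)[OF f]] show ?thesis by metis
  qed
  have 3: "hessian f y w (a *\<^sub>R u) = a *\<^sub>R hessian f y w u" for w u a
  proof -
    have "((\<lambda>y. a *\<^sub>R fderiv f y u) has_derivative (\<lambda>w. a *\<^sub>R hessian f y w u)) (at y)"
      by (intro derivative_intros C_2_onD(2)[OF f])
    then have "((\<lambda>y. fderiv f y (a *\<^sub>R u)) has_derivative (\<lambda>w. a *\<^sub>R hessian f y w u)) (at y)"
      by (rule has_derivative_transform_within_open[OF _ S f(2)]) (simp add: linear_scale[OF lin])
    from has_derivative_unique[OF this C_2_onD(2)[OF f]] show ?thesis by metis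
  qed
  show ?thesis unfolding bilinear_def using 1 2 3 by (auto intro: linearI)
qed

lemma line_derivatives:
  assumes f: "C_k_on 2 S f" "z + t *\<^sub>R v \<in> S"
  shows "((\<lambda>t. f (z + t *\<^sub>R v)) has_real_derivative fderiv f (z + t *\<^sub>R v) v) (at t)"
    and "((\<lambda>t. fderiv f (z + t *\<^sub>R v) v) has_real_derivative hessian f (z + t *\<^sub>R v) v v) (at t)"
proof -
  have l: "((\<lambda>t. z + t *\<^sub>R v) has_derivative (\<lambda>t. t *\<^sub>R v)) (at t)"
    by (auto intro!: derivative_eq_intros)
  have "((\<lambda>t. f (z + t *\<^sub>R v)) has_derivative (\<lambda>s. fderiv f (z + t *\<^sub>R v) v * s)) (at t)"
    using has_derivative_compose[OF l C_2_onD(1)[OF f]]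
    by (simp add: linear_scale[OF linear_fderiv[OF f]] mult.commute[of _ "fderiv f _ v"])
  then show "((\<lambda>t. f (z + t *\<^sub>R v)) has_real_derivative fderiv f (z + t *\<^sub>R v) v) (at t)"
    by (simp add: has_field_derivative_def)
  have "((\<lambda>t. fderiv f (z + t *\<^sub>R v) v) has_derivative
      (\<lambda>s. hessian f (z + t *\<^sub>R v) v v * s)) (at t)"
    using has_derivative_compose[OF l C_2_onD(2)[OF f, of v]]
    by (simp add: linear_scale[OF has_derivative_linear[OF C_2_onD(2)[OF f, of v]]]
      mult.commute[of _ "hessian f _ v v"])
  then show "((\<lambda>t. fderiv f (z + t *\<^sub>R v) v) has_real_derivative hessian f (z + t *\<^sub>R v) v v) (at t)"
    by (simp add: has_field_derivative_def)
qed

section \<open>Superlevel sets near regular and critical points\<close>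

text \<open>Near \<open>p\<close> the function increases strictly along short segments in a
  direction \<open>v\<close> of positive derivative. Hence each point above the level is joined to
  the upper end of its segment within the superlevel set.\<close>

lemma local_superlevel_regular:
  assumes f: "C_k_on 2 S f" and S: "open S" "p \<in> S" and e: "fderiv f p e \<noteq> 0"
  shows "\<exists>W. open W \<and> p \<in> W \<and> W \<subseteq> S \<and> connected {y\<in>W. f y > f p} \<and> {y\<in>W. f y > f p} \<noteq> {}"
proof -
  obtain v where v: "fderiv f p v > 0"
    using e linear_neg[OF linear_fderiv[OF f S(2)], of e]
    by (cases "fderiv f p e > 0") (auto intro: that[of e] that[of "- e"])
  let ?N = "S \<inter> (\<lambda>y. fderiv f y v) -` {0<..}"
  have N: "open ?N"
    by (rule continuous_open_preimage[OF C_2_on_continuous(1)[OF f] S(1) open_greaterThan])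
  obtain \<rho> where \<rho>: "\<rho> > 0" "ball p \<rho> \<subseteq> ?N"
    using N S v unfolding open_contains_ball by blast
  \<comment> \<open>The summand 1 excludes a zero denominator and the final factor gives the strict
    bound \<open>r * norm v < \<rho>\<close>.\<close>
  define r where "r = \<rho> / (norm v + 1) / 2"
  have "norm v + 1 > 0" by (simp add: add_nonneg_pos)
  then have r: "r > 0" "r * norm v < \<rho>"
    using \<rho>(1) by (simp_all add: r_def field_simps add_strict_increasing)
  have inc: "f (q + s *\<^sub>R v) < f (q + t *\<^sub>R v)"
    if "\<And>s. s \<in> {0..r} \<Longrightarrow> q + s *\<^sub>R v \<in> ball p \<rho>" "0 \<le> s" "s < t" "t \<le> r" for q s t
  proof (rule DERIV_pos_imp_increasing[OF that(3)])
    fix x assume "s \<le> x" "x \<le> t"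
    then have "q + x *\<^sub>R v \<in> ?N" using that \<rho>(2) by (meson atLeastAtMost_iff order_trans subsetD)
    then show "\<exists>y. ((\<lambda>t. f (q + t *\<^sub>R v)) has_real_derivative y) (at x) \<and> 0 < y"
      using line_derivatives(1)[OF f] by fastforce
  qed
  have KN: "p + s *\<^sub>R v \<in> ball p \<rho>" if "s \<in> {0..r}" for s
    using that r mult_right_mono[of s r "norm v"] by (auto simp: dist_norm)
  have "\<exists>W. open W \<and> p \<in> W \<and> W \<subseteq> ball p \<rho> \<and> connected {y\<in>W. f y > f p} \<and> {y\<in>W. f y > f p} \<noteq> {}"
  proof (rule local_superlevel_of_family[where K = "{0..r}" and T = "\<lambda>s. s *\<^sub>R v" and B = "{r}" and a = 0])
    show "continuous_on (ball p \<rho>) f"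
      using C_2_on_continuous(3)[OF f] \<rho>(2) continuous_on_subset by blast
    show "f p < f (p + s *\<^sub>R v)" if "s \<in> {r}" for s
      using inc[of p 0 r] KN r that by auto
    fix q s
    assume q: "\<And>s. s \<in> {0..r} \<Longrightarrow> q + s *\<^sub>R v \<in> ball p \<rho>" and s: "s \<in> {0..r}" "f (q + s *\<^sub>R v) > f p"
    have "f (q + t *\<^sub>R v) > f p" if "t \<in> {s..r}" for t
      using inc[OF q, of s t] s that by (cases "s = t") auto
    then show "\<exists>D. connected D \<and> s \<in> D \<and> D \<subseteq> {0..r} \<and> D \<inter> {r} \<noteq> {} \<and> (\<forall>d\<in>D. f (q + d *\<^sub>R v) > f p)"
      using s r by (intro exI[of _ "{s..r}"]) auto
  qed (use KN r in \<open>auto intro!: continuous_intros\<close>)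
  then show ?thesis using \<rho>(2) by (meson Int_lower1 subset_trans)
qed

text \<open>The conditions on \<open>v\<close> and \<open>w\<close> make the Hessian positive
  definite on their span. The family consists of translates of a small disc in that plane, with
  \<open>B\<close> the boundary circle. Strict growth along rays from \<open>p\<close> puts the
  central circle above the level; convexity along chords parallel to \<open>v\<close> joins points
  of a nearby disc to its circle.\<close>

lemma local_superlevel_critical:
  assumes f: "C_k_on 2 S f" and S: "open S" "p \<in> S" and crit: "fderiv f p = (\<lambda>_. 0)"
    and v: "hessian f p v v > 0" and w: "hessian f p w w > 0"
    and vw: "hessian f p v w + hessian f p w v = 0"
  shows "\<exists>W. open W \<and> p \<in> W \<and> W \<subseteq> S \<and> connected {y\<in>W. f y > f p} \<and> {y\<in>W. f y > f p} \<noteq> {}"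
proof -
  \<comment> \<open>Four times the determinant of the symmetrised 2 by 2 matrix. Its positivity
    together with that of the first diagonal entry is an open condition and characterises positive
    definiteness.\<close>
  define \<Delta> where "\<Delta> y = 4 * hessian f y v v * hessian f y w w - (hessian f y v w + hessian f y w v)\<^sup>2" for y
  let ?N = "(S \<inter> (\<lambda>y. hessian f y v v) -` {0<..}) \<inter> (S \<inter> \<Delta> -` {0<..})"
  have "open (S \<inter> (\<lambda>y. hessian f y v v) -` {0<..})" "open (S \<inter> \<Delta> -` {0<..})"
    unfolding \<Delta>_def
    by (intro continuous_open_preimage S open_greaterThan continuous_intros C_2_on_continuous(2)[OF f])+
  then have N: "open ?N" by blast
  have "p \<in> ?N" using S v w vw by (simp add: \<Delta>_def)
  then obtain \<rho> where \<rho>: "\<rho> > 0" "ball p \<rho> \<subseteq> ?N"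
    using N unfolding open_contains_ball by metis
  define T where "T s = Re s *\<^sub>R v + Im s *\<^sub>R w" for s
  define r where "r = \<rho> / (norm v + norm w + 1) / 2"
  have "norm v + norm w + 1 > 0" by (simp add: add_nonneg_pos)
  then have r: "r > 0" "r * (norm v + norm w) < \<rho>"
    using \<rho>(1) by (simp_all add: r_def field_simps add_strict_increasing)
  have T: "norm (T s) < \<rho>" if "norm s \<le> r" for s
  proof -
    have "norm (T s) \<le> \<bar>Re s\<bar> * norm v + \<bar>Im s\<bar> * norm w"
      unfolding T_def by (metis norm_scaleR norm_triangle_ineq)
    also have "\<dots> \<le> r * norm v + r * norm w"
      using that abs_Re_le_cmod[of s] abs_Im_le_cmod[of s] by (intro add_mono mult_right_mono) auto
    also have "\<dots> < \<rho>" using r by (simp add: algebra_simps)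
    finally show ?thesis .
  qed
  have pos: "hessian f y (T s) (T s) > 0" if "y \<in> ball p \<rho>" "s \<noteq> 0" for y s
  proof -
    have y: "y \<in> S" "hessian f y v v > 0" "\<Delta> y > 0" using that \<rho>(2) by auto
    note h = bilinear_hessian[OF f y(1) S(1)]
    define a b where "a = Re s" and "b = Im s"
    let ?A = "hessian f y v v" and ?B = "hessian f y v w + hessian f y w v" and ?C = "hessian f y w w"
    have "hessian f y (T s) (T s) = a\<^sup>2 * ?A + a * b * ?B + b\<^sup>2 * ?C"
      by (simp add: T_def a_def b_def bilinear_ladd[OF h] bilinear_radd[OF h] bilinear_lmul[OF h]
        bilinear_rmul[OF h] power2_eq_square algebra_simps)
    \<comment> \<open>Completing the square in \<open>a\<close>.\<close>
    then have "4 * ?A * hessian f y (T s) (T s) = (2 * a * ?A + b * ?B)\<^sup>2 + b\<^sup>2 * \<Delta> y"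
      by (simp add: \<Delta>_def power2_eq_square algebra_simps)
    moreover have "(2 * a * ?A + b * ?B)\<^sup>2 + b\<^sup>2 * \<Delta> y > 0"
    proof (cases "b = 0")
      case True
      then have "a \<noteq> 0" using that(2) by (auto simp: a_def b_def complex_eq_iff)
      then show ?thesis using True y by simp
    next
      case False
      then show ?thesis using y by (simp add: add_nonneg_pos)
    qed
    ultimately have "0 < 4 * ?A * hessian f y (T s) (T s)" by simp
    then show ?thesis using y by (simp add: zero_less_mult_iff)
  qed
  have "\<exists>W. open W \<and> p \<in> W \<and> W \<subseteq> ball p \<rho> \<and> connected {y\<in>W. f y > f p} \<and> {y\<in>W. f y > f p} \<noteq> {}"
  proof (rule local_superlevel_of_family[where K = "cball 0 r" and T = T and B = "sphere 0 r" and a = 0])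
    show "continuous_on (ball p \<rho>) f"
      using C_2_on_continuous(3)[OF f] \<rho>(2) continuous_on_subset by blast
    show "continuous_on (cball 0 r) T" unfolding T_def by (intro continuous_intros)
    show "sphere (0::complex) r \<noteq> {}" using r by simp
    show "connected (sphere (0::complex) r)" by (rule connected_sphere) simp
    show "p + T s \<in> ball p \<rho>" if "s \<in> cball 0 r" for s
      using T[of s] that by (simp add: dist_norm)
    show "f p < f (p + T s)" if s: "s \<in> sphere 0 r" for s
    proof -
      have "s \<noteq> 0" using s r by auto
      have in_ball: "p + t *\<^sub>R T s \<in> ball p \<rho>" if "t \<in> {0..1}" for t
      proof -
        have "norm (t *\<^sub>R T s) \<le> norm (T s)"
          using that mult_left_le_one_le[of "norm (T s)" t] by simp
        then show ?thesis using T[of s] s by (simp add: dist_norm)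
      qed
      then have inS: "p + t *\<^sub>R T s \<in> S" if "t \<in> {0..1}" for t using that \<rho>(2) by blast
      \<comment> \<open>The radial derivative vanishes at the critical point \<open>p\<close> and
        increases along the ray, as its own derivative is a positive Hessian value.\<close>
      have d: "fderiv f (p + t *\<^sub>R T s) (T s) > 0" if t: "0 < t" "t \<le> 1" for t
      proof -
        have "fderiv f (p + 0 *\<^sub>R T s) (T s) < fderiv f (p + t *\<^sub>R T s) (T s)"
        proof (rule DERIV_pos_imp_increasing[OF t(1)])
          fix x assume "0 \<le> x" "x \<le> t"
          then have "x \<in> {0..1}" using t by auto
          then show "\<exists>y. ((\<lambda>t. fderiv f (p + t *\<^sub>R T s) (T s)) has_real_derivative y) (at x) \<and> 0 < y"
            using line_derivatives(2)[OF f inS] pos[OF in_ball \<open>s \<noteq> 0\<close>] by blast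
        qed
        then show ?thesis using crit by simp
      qed
      have "f (p + 0 *\<^sub>R T s) < f (p + 1 *\<^sub>R T s)"
      proof (rule DERIV_pos_imp_increasing_open[where f = "\<lambda>t. f (p + t *\<^sub>R T s)"])
        fix x :: real assume "0 < x" "x < 1"
        then show "\<exists>y. ((\<lambda>t. f (p + t *\<^sub>R T s)) has_real_derivative y) (at x) \<and> 0 < y"
          using line_derivatives(1)[OF f inS, of x] d[of x] by auto
      next
        show "continuous_on {0..1} (\<lambda>t. f (p + t *\<^sub>R T s))"
          by (rule continuous_on_compose2[OF C_2_on_continuous(3)[OF f]])
            (use inS in \<open>auto intro!: continuous_intros\<close>)
      qed simp
      then show ?thesis by simp
    qed
    fix q s
    assume q: "\<And>s. s \<in> cball 0 r \<Longrightarrow> q + T s \<in> ball p \<rho>" and s: "s \<in> cball 0 r" "f (q + T s) > f p"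
    define a b where "a = Re s" and "b = Im s"
    \<comment> \<open>Half the length of the chord of the disc at height \<open>b\<close>, on which
      \<open>s\<close> lies.\<close>
    define l where "l = sqrt (r\<^sup>2 - b\<^sup>2)"
    have ab: "a\<^sup>2 + b\<^sup>2 \<le> r\<^sup>2"
      using s(1) r power_mono[of "norm s" r 2] by (simp add: a_def b_def cmod_power2)
    then have "\<bar>a\<bar> \<le> l" by (simp add: l_def real_le_rsqrt)
    then have al: "a \<in> {-l..l}" "l \<ge> 0" by auto
    have l2: "l\<^sup>2 = r\<^sup>2 - b\<^sup>2"
      unfolding l_def using ab zero_le_power2[of a] by (intro real_sqrt_pow2) linarith
    have disc: "Complex t b \<in> cball 0 r" if "t \<in> {-l..l}" for t
    proof -
      have "t\<^sup>2 \<le> l\<^sup>2" using that al abs_le_square_iff[of t l] by auto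
      then show ?thesis using l2 r(1) by (simp add: cmod_def real_le_lsqrt)
    qed
    have circle: "Complex l b \<in> sphere 0 r" "Complex (-l) b \<in> sphere 0 r"
      using l2 r(1) by (simp_all add: cmod_def)
    define g where "g t = f (q + T (Complex t b))" for t
    have g: "g t = f ((q + b *\<^sub>R w) + t *\<^sub>R v)" for t
      by (simp add: g_def T_def algebra_simps)
    have inN: "(q + b *\<^sub>R w) + t *\<^sub>R v \<in> ?N" if "t \<in> {-l..l}" for t
      using q[OF disc[OF that]] \<rho>(2) by (auto simp: T_def algebra_simps)
    have convex: "convex_on {-l..l} g"
    proof (rule f''_ge0_imp_convex)
      fix t assume t: "t \<in> {-l..l}"
      show "(g has_real_derivative fderiv f ((q + b *\<^sub>R w) + t *\<^sub>R v) v) (at t)"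
        unfolding g using inN[OF t] by (intro line_derivatives(1)[OF f]) auto
      show "((\<lambda>t. fderiv f ((q + b *\<^sub>R w) + t *\<^sub>R v) v) has_real_derivative
          hessian f ((q + b *\<^sub>R w) + t *\<^sub>R v) v v) (at t)"
        using inN[OF t] by (intro line_derivatives(2)[OF f]) auto
      show "hessian f ((q + b *\<^sub>R w) + t *\<^sub>R v) v v \<ge> 0" using inN[OF t] by auto
    qed simp
    have ga: "g a > f p" using s by (simp add: g_def a_def b_def)
    \<comment> \<open>A convex function cannot exceed the level at \<open>a\<close> if it is at most
      the level at some point on either side. So one of the two half-chords from \<open>a\<close> to
      the circle stays above the level.\<close>
    have "(\<forall>t\<in>{-l..a}. g t > f p) \<or> (\<forall>t\<in>{a..l}. g t > f p)"
    proof (rule ccontr)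
      assume "\<not> ?thesis"
      then obtain t1 t2 where t: "t1 \<in> {-l..a}" "t2 \<in> {a..l}" "g t1 \<le> f p" "g t2 \<le> f p"
        by (auto simp: not_less)
      have "convex_on {t1..t2} g" using convex t al by (auto intro: convex_on_subset)
      then have "g a \<le> max (g t1) (g t2)" using t by (intro convex_on_le_max) auto
      then show False using t ga by auto
    qed
    then obtain I where I: "connected I" "a \<in> I" "I \<subseteq> {-l..l}" "l \<in> I \<or> -l \<in> I" "\<And>t. t \<in> I \<Longrightarrow> g t > f p"
    proof
      assume "\<forall>t\<in>{-l..a}. g t > f p"
      then show ?thesis using al by (intro that[of "{-l..a}"]) auto
    next
      assume "\<forall>t\<in>{a..l}. g t > f p"
      then show ?thesis using al by (intro that[of "{a..l}"]) auto
    qed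
    have "continuous_on I (\<lambda>t. Complex t b)"
      unfolding Complex_eq by (intro continuous_intros)
    then have "connected ((\<lambda>t. Complex t b) ` I)"
      using I(1) by (rule connected_continuous_image)
    moreover have "s \<in> (\<lambda>t. Complex t b) ` I"
      using I(2) by (auto simp: a_def b_def intro!: image_eqI[of _ _ "Re s"])
    moreover have "(\<lambda>t. Complex t b) ` I \<subseteq> cball 0 r" using disc I(3) by blast
    moreover have "(\<lambda>t. Complex t b) ` I \<inter> sphere 0 r \<noteq> {}" using circle I(4) by blast
    ultimately show "\<exists>D. connected D \<and> s \<in> D \<and> D \<subseteq> cball 0 r \<and> D \<inter> sphere 0 r \<noteq> {} \<and>
        (\<forall>d\<in>D. f (q + T d) > f p)"
      using I(5) unfolding g_def by (intro exI[of _ "(\<lambda>t. Complex t b) ` I"]) blast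
  qed (use r in \<open>auto simp: T_def\<close>)
  then show ?thesis using \<rho>(2) by blast
qed

subsection \<open>Almost complex manifolds\<close>

lemma C_2_on_subset: "C_k_on 2 S f \<Longrightarrow> T \<subseteq> S \<Longrightarrow> C_k_on 2 T f"
  unfolding numeral_2_eq_2 C_k_on.simps by (meson continuous_on_subset subsetD)

lemma C_infinity_on_differentiable: "C_infinity_on S f \<Longrightarrow> y \<in> S \<Longrightarrow> f differentiable (at y)"
  unfolding C_infinity_on_def by (metis C_k_on.simps(2))

section \<open>Tangent vectors and differentials in charts\<close>

locale atlas =
  fixes A :: "('x::{t2_space,second_countable_topology}, 'e::euclidean_space) chart set"
  assumes atlas: "smooth_atlas A"
begin

lemma chart_homeomorphism:
  assumes "c \<in> A"
  shows "homeomorphism (chart_dom c) (chart_map c ` chart_dom c) (chart_map c) (chart_inv c)"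
    and "open (chart_dom c)" and "open (chart_map c ` chart_dom c)"
  using atlas assms by (auto simp: smooth_atlas_def)

lemma chart_inv_map [simp]: "c \<in> A \<Longrightarrow> x \<in> chart_dom c \<Longrightarrow> chart_inv c (chart_map c x) = x"
  using chart_homeomorphism(1) by (rule homeomorphism_apply1)

lemma open_chart_image:
  assumes "c \<in> A" "open U" shows "open (chart_map c ` (chart_dom c \<inter> U))"
  using homeomorphism_imp_open_map[OF chart_homeomorphism(1)[OF assms(1)], of "chart_dom c \<inter> U"]
    chart_homeomorphism(3)[OF assms(1)] assms(2) openin_open_trans by blast

lemma continuous_chart_inv: "c \<in> A \<Longrightarrow> continuous_on (chart_map c ` chart_dom c) (chart_inv c)"
  and continuous_chart_map: "c \<in> A \<Longrightarrow> continuous_on (chart_dom c) (chart_map c)"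
  using chart_homeomorphism(1) by (auto simp: homeomorphism_def)

lemma open_chart_inv_image:
  assumes "c \<in> A" "open W" "W \<subseteq> chart_map c ` chart_dom c" shows "open (chart_inv c ` W)"
proof -
  have "openin (top_of_set (chart_dom c)) (chart_inv c ` W)"
    by (rule homeomorphism_imp_open_map[OF homeomorphism_symD[OF chart_homeomorphism(1)[OF assms(1)]]
      open_subset[OF assms(3,2)]])
  then show ?thesis using chart_homeomorphism(2)[OF assms(1)] openin_open_trans by blast
qed

lemma some_chart: "some_chart A x \<in> A" "x \<in> chart_dom (some_chart A x)"
proof -
  have "x \<in> (\<Union>c\<in>A. chart_dom c)" using atlas unfolding smooth_atlas_def by blast
  then have "\<exists>c. c \<in> A \<and> x \<in> chart_dom c" by blast
  then have "some_chart A x \<in> A \<and> x \<in> chart_dom (some_chart A x)"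
    unfolding some_chart_def by (rule someI_ex)
  then show "some_chart A x \<in> A" "x \<in> chart_dom (some_chart A x)" by auto
qed

lemma transition_differentiable:
  assumes "c \<in> A" "d \<in> A" "x \<in> chart_dom c" "x \<in> chart_dom d"
  shows "(chart_map d \<circ> chart_inv c) differentiable (at (chart_map c x))"
  using atlas assms by (intro C_infinity_on_differentiable) (auto simp: smooth_atlas_def)

text \<open>Chain rule for the transition map on the overlap of the charts. With \<open>g\<close> a
  coordinate map it becomes the cocycle rule that makes \<open>coord_vector\<close> a tangent
  vector.\<close>

lemma derivative_change_chart:
  fixes g :: "'x \<Rightarrow> 'b::real_normed_vector"
  assumes "c \<in> A" "d \<in> A" "x \<in> chart_dom c" "x \<in> chart_dom d"
    and g: "(g \<circ> chart_inv d) differentiable (at (chart_map d x))"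
  shows "frechet_derivative (g \<circ> chart_inv c) (at (chart_map c x)) u =
    frechet_derivative (g \<circ> chart_inv d) (at (chart_map d x))
      (frechet_derivative (chart_map d \<circ> chart_inv c) (at (chart_map c x)) u)"
proof -
  let ?t = "chart_map d \<circ> chart_inv c" and ?p = "chart_map c x"
  have t: "?t differentiable (at ?p)" by (rule transition_differentiable) fact+
  have tp: "?t ?p = chart_map d x" using assms by simp
  have "frechet_derivative ((g \<circ> chart_inv d) \<circ> ?t) (at ?p) = frechet_derivative (g \<circ> chart_inv c) (at ?p)"
  proof (rule frechet_derivative_transform_within_open)
    show "((g \<circ> chart_inv d) \<circ> ?t) differentiable (at ?p)"
      using t g tp by (intro differentiable_chain_at) simp_all
    show "open (chart_map c ` (chart_dom c \<inter> chart_dom d))"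
      using assms by (intro open_chart_image chart_homeomorphism)
  qed (use assms in auto)
  moreover have "frechet_derivative ((g \<circ> chart_inv d) \<circ> ?t) (at ?p) =
      frechet_derivative (g \<circ> chart_inv d) (at (?t ?p)) \<circ> frechet_derivative ?t (at ?p)"
    using t g tp by (intro frechet_derivative_compose) simp_all
  ultimately show ?thesis using tp by (metis comp_apply)
qed

lemma transition_self:
  assumes "c \<in> A" "x \<in> chart_dom c"
  shows "frechet_derivative (chart_map c \<circ> chart_inv c) (at (chart_map c x)) u = u"
proof -
  have "frechet_derivative (\<lambda>y. y) (at (chart_map c x)) =
      frechet_derivative (chart_map c \<circ> chart_inv c) (at (chart_map c x))"
    by (rule frechet_derivative_transform_within_open[OF _ chart_homeomorphism(3)[OF assms(1)]])
      (use assms in auto)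
  then show ?thesis by (metis frechet_derivative_ident)
qed

lemma linear_transition:
  assumes "c \<in> A" "d \<in> A" "x \<in> chart_dom c" "x \<in> chart_dom d"
  shows "linear (frechet_derivative (chart_map d \<circ> chart_inv c) (at (chart_map c x)))"
  by (rule linear_frechet_derivative[OF transition_differentiable[OF assms]])

context
  fixes c x
  assumes c: "c \<in> A" "x \<in> chart_dom c"
begin

lemma coord_vector_self [simp]: "coord_vector A c x u c = u"
  using c transition_self by (simp add: coord_vector_def)

lemma coord_vector_tangent: "coord_vector A c x u \<in> tangent_space A x"
  unfolding tangent_space_def mem_Collect_eq
proof (intro conjI ballI allI impI)
  fix d assume "d \<notin> A \<or> x \<notin> chart_dom d"
  then show "coord_vector A c x u d = 0" unfolding coord_vector_def by (intro if_not_P) blast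
next
  fix d e assume de: "d \<in> A" "e \<in> A" and "x \<in> chart_dom d \<inter> chart_dom e"
  then have x: "x \<in> chart_dom d" "x \<in> chart_dom e" by auto
  show "coord_vector A c x u e =
      frechet_derivative (chart_map e \<circ> chart_inv d) (at (chart_map d x)) (coord_vector A c x u d)"
    using derivative_change_chart[OF c(1) de(1) c(2) x(1) transition_differentiable[OF de x]] de x
    by (simp add: coord_vector_def)
qed

text \<open>Together with \<open>coord_vector_self\<close> this identifies the tangent space at
  \<open>x\<close> with the model space through a single chart; the value 0 outside the charts
  around \<open>x\<close> makes the representation unique.\<close>

lemma tangent_eq_coord_vector:
  assumes "v \<in> tangent_space A x" shows "coord_vector A c x (v c) = v"
proof
  fix d
  show "coord_vector A c x (v c) d = v d"
  proof (cases "d \<in> A \<and> x \<in> chart_dom d")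
    case True
    then have "v d = frechet_derivative (chart_map d \<circ> chart_inv c) (at (chart_map c x)) (v c)"
      using assms c unfolding tangent_space_def by blast
    then show ?thesis using True by (simp add: coord_vector_def)
  next
    case False
    moreover have "v d = 0" using assms False unfolding tangent_space_def by blast
    ultimately show ?thesis by (simp add: coord_vector_def if_not_P)
  qed
qed

lemma coord_vector_linear:
  "coord_vector A c x (a *\<^sub>R u + b *\<^sub>R w) =
    (\<lambda>d. a *\<^sub>R coord_vector A c x u d + b *\<^sub>R coord_vector A c x w d)"
proof
  fix d
  show "coord_vector A c x (a *\<^sub>R u + b *\<^sub>R w) d =
      a *\<^sub>R coord_vector A c x u d + b *\<^sub>R coord_vector A c x w d"
  proof (cases "d \<in> A \<and> x \<in> chart_dom d")
    case True
    then have "linear (frechet_derivative (chart_map d \<circ> chart_inv c) (at (chart_map c x)))"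
      using linear_transition c by blast
    then show ?thesis using True by (simp add: coord_vector_def linear_add linear_scale)
  qed (simp add: coord_vector_def if_not_P)
qed

text \<open>The tangent vector transforms by the derivative of the transition map, so the chain rule
  cancels the dependence on the selected chart. Differentiability is asked in every chart around
  \<open>x\<close>, and thus holds in the selected one.\<close>

lemma differential_in_chart:
  assumes "v \<in> tangent_space A x"
    and "\<And>d. d \<in> A \<Longrightarrow> x \<in> chart_dom d \<Longrightarrow> (g \<circ> chart_inv d) differentiable (at (chart_map d x))"
  shows "differential A g x v = frechet_derivative (g \<circ> chart_inv c) (at (chart_map c x)) (v c)"
proof -
  let ?d = "some_chart A x"
  have "v ?d = frechet_derivative (chart_map ?d \<circ> chart_inv c) (at (chart_map c x)) (v c)"
    using assms(1) c some_chart unfolding tangent_space_def by blast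
  then show ?thesis
    using derivative_change_chart[OF c(1) some_chart(1) c(2) some_chart(2) assms(2)[OF some_chart]]
    unfolding differential_def Let_def by simp
qed

end

lemma C_2_function_continuous:
  assumes "open \<Omega>" "C_k_function 2 A \<Omega> \<phi>"
  shows "continuous_on \<Omega> \<phi>"
  unfolding continuous_on_eq_continuous_at[OF assms(1)]
proof
  fix x assume "x \<in> \<Omega>"
  let ?c = "some_chart A x" and ?U = "chart_dom (some_chart A x) \<inter> \<Omega>"
  have "continuous_on (chart_map ?c ` ?U) (\<phi> \<circ> chart_inv ?c)"
    using assms(2) some_chart(1) unfolding C_k_function_def by (intro C_2_on_continuous(3)) blast
  then have "continuous_on ?U (\<lambda>y. (\<phi> \<circ> chart_inv ?c) (chart_map ?c y))"
    by (rule continuous_on_compose2)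
      (auto intro: continuous_on_subset[OF continuous_chart_map[OF some_chart(1)]])
  then have "continuous_on ?U \<phi>"
    by (rule continuous_on_eq) (simp add: some_chart)
  moreover have "open ?U" using assms(1) chart_homeomorphism(2)[OF some_chart(1)] by blast
  ultimately show "isCont \<phi> x"
    using \<open>x \<in> \<Omega>\<close> some_chart(2) continuous_on_eq_continuous_at by blast
qed

lemma local_superlevel_from_chart:
  assumes c: "c \<in> A" "x \<in> chart_dom c" and V: "V \<subseteq> chart_dom c"
    and W: "open W" "chart_map c x \<in> W" "W \<subseteq> chart_map c ` V"
      "connected {y\<in>W. (\<phi> \<circ> chart_inv c) y > (\<phi> \<circ> chart_inv c) (chart_map c x)}" (is "connected ?P")
      "{y\<in>W. (\<phi> \<circ> chart_inv c) y > (\<phi> \<circ> chart_inv c) (chart_map c x)} \<noteq> {}"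
  shows "\<exists>W. open W \<and> x \<in> W \<and> W \<subseteq> V \<and> connected {y\<in>W. \<phi> y > \<phi> x} \<and> {y\<in>W. \<phi> y > \<phi> x} \<noteq> {}"
proof (intro exI conjI)
  have WV: "W \<subseteq> chart_map c ` chart_dom c" using V W by blast
  show "open (chart_inv c ` W)" by (rule open_chart_inv_image) fact+
  show "x \<in> chart_inv c ` W" using W(2) c by (auto intro!: image_eqI[of _ _ "chart_map c x"])
  show "chart_inv c ` W \<subseteq> V" using W(3) V c(1) by fastforce
  have eq: "{y \<in> chart_inv c ` W. \<phi> y > \<phi> x} = chart_inv c ` ?P" using c by auto
  show "connected {y \<in> chart_inv c ` W. \<phi> y > \<phi> x}" unfolding eq
    by (rule connected_continuous_image[OF continuous_on_subset[OF continuous_chart_inv[OF c(1)]] W(4)])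
      (use WV in blast)
  show "{y \<in> chart_inv c ` W. \<phi> y > \<phi> x} \<noteq> {}" unfolding eq using W(5) by blast
qed

end

section \<open>The almost complex structure and the form \<open>dd^c\<close> in coordinates\<close>

locale almost_complex = atlas A
  for A :: "('x::{t2_space,second_countable_topology}, 'e::euclidean_space) chart set" +
  fixes J :: "'x \<Rightarrow> ('x, 'e) tangent_vector \<Rightarrow> ('x, 'e) tangent_vector"
  assumes almost_complex: "almost_complex_manifold A J"
begin

text \<open>The matrix field of \<open>J\<close> in the coordinate frame of \<open>c\<close>, as a
  function of the coordinates \<open>y\<close>; for fixed \<open>u\<close> it is the expression
  required to be smooth in \<open>smooth_bundle_endomorphism\<close>.\<close>

definition J_coord :: "('x, 'e) chart \<Rightarrow> 'e \<Rightarrow> 'e \<Rightarrow> 'e" where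
  "J_coord c y u = J (chart_inv c y) (coord_vector A c (chart_inv c y) u) c"

lemma J_tangent: "v \<in> tangent_space A x \<Longrightarrow> J x v \<in> tangent_space A x"
  and J_squared: "v \<in> tangent_space A x \<Longrightarrow> J x (J x v) = (\<lambda>c. - v c)"
  and J_linear: "v \<in> tangent_space A x \<Longrightarrow> w \<in> tangent_space A x \<Longrightarrow>
    J x (\<lambda>c. a *\<^sub>R v c + b *\<^sub>R w c) = (\<lambda>c. a *\<^sub>R J x v c + b *\<^sub>R J x w c)"
  using almost_complex unfolding almost_complex_manifold_def smooth_bundle_endomorphism_def by blast+

lemma J_coord_differentiable:
  assumes "c \<in> A" "y \<in> chart_map c ` chart_dom c"
  shows "(\<lambda>y. J_coord c y u) differentiable (at y)"
  using almost_complex assms unfolding J_coord_def almost_complex_manifold_def smooth_bundle_endomorphism_def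
  by (intro C_infinity_on_differentiable) blast+

context
  fixes c x
  assumes c: "c \<in> A" "x \<in> chart_dom c"
begin

lemma J_in_chart: "v \<in> tangent_space A x \<Longrightarrow> J x v c = J_coord c (chart_map c x) (v c)"
  using c by (simp add: J_coord_def tangent_eq_coord_vector)

lemma J_coord_squared: "J_coord c (chart_map c x) (J_coord c (chart_map c x) u) = - u"
proof -
  let ?v = "coord_vector A c x u"
  have v: "?v \<in> tangent_space A x" by (rule coord_vector_tangent[OF c])
  have "J x (J x ?v) c = J_coord c (chart_map c x) (J_coord c (chart_map c x) u)"
    using J_in_chart[OF v] J_in_chart[OF J_tangent[OF v]] c by simp
  then show ?thesis using J_squared[OF v] c by simp
qed

lemma linear_J_coord: "linear (J_coord c (chart_map c x))"
proof (rule linearI)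
  have *: "J_coord c (chart_map c x) (a *\<^sub>R u + b *\<^sub>R w) =
      a *\<^sub>R J_coord c (chart_map c x) u + b *\<^sub>R J_coord c (chart_map c x) w" for a b u w
    using c J_linear coord_vector_tangent[OF c] by (simp add: J_coord_def coord_vector_linear)
  show "J_coord c (chart_map c x) (u + w) = J_coord c (chart_map c x) u + J_coord c (chart_map c x) w" for u w
    using *[of 1 u 1 w] by simp
  show "J_coord c (chart_map c x) (a *\<^sub>R u) = a *\<^sub>R J_coord c (chart_map c x) u" for a u
    using *[of a u 0 0] by simp
qed

end

text \<open>The chart \<open>c\<close> is the one in which \<open>exterior_derivative\<close> is
  evaluated at \<open>x\<close>.\<close>

context
  fixes \<Omega> :: "'x set" and \<phi> :: "'x \<Rightarrow> real" and x c
  assumes open_domain: "open \<Omega>" and C2: "C_k_function 2 A \<Omega> \<phi>" and x: "x \<in> \<Omega>"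
  defines "c \<equiv> some_chart A x"
begin

lemma C_2_in_chart: "C_k_on 2 (chart_map c ` (chart_dom c \<inter> \<Omega>)) (\<phi> \<circ> chart_inv c)"
  using C2 some_chart by (auto simp: C_k_function_def c_def)

text \<open>\<open>differential\<close> selects a chart separately at each point, whereas
  differentiating the form at \<open>x\<close> takes place in the fixed chart \<open>c\<close>.
  Chart independence gives one formula valid on all of the coordinate image.\<close>

lemma d_c_in_chart:
  assumes "y \<in> chart_map c ` (chart_dom c \<inter> \<Omega>)"
  shows "d_c A J \<phi> (chart_inv c y) (coord_vector A c (chart_inv c y) u) =
    - fderiv (\<phi> \<circ> chart_inv c) y (J_coord c y u)"
proof -
  obtain z where z: "y = chart_map c z" "z \<in> chart_dom c" "z \<in> \<Omega>" using assms by blast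
  have c: "c \<in> A" unfolding c_def by (rule some_chart)
  have "(\<phi> \<circ> chart_inv d) differentiable (at (chart_map d z))" if "d \<in> A" "z \<in> chart_dom d" for d
  proof -
    have "C_k_on 2 (chart_map d ` (chart_dom d \<inter> \<Omega>)) (\<phi> \<circ> chart_inv d)"
      using C2 that by (auto simp: C_k_function_def)
    from C_2_onD(1)[OF this] show ?thesis using that z by (auto simp: differentiable_def)
  qed
  from differential_in_chart[OF c z(2) J_tangent[OF coord_vector_tangent[OF c z(2)]] this]
  show ?thesis using c z by (simp add: d_c_def fderiv_def J_coord_def)
qed

text \<open>At a critical point the terms of \<open>dd\<^sup>c\<close> that contain derivatives of \<open>J\<close> vanish.\<close>

lemma dd_c_critical:
  assumes crit: "fderiv (\<phi> \<circ> chart_inv c) (chart_map c x) = (\<lambda>_. 0)" and v: "v \<in> tangent_space A x"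
  shows "exterior_derivative A (d_c A J \<phi>) x v (J x v) =
    hessian (\<phi> \<circ> chart_inv c) (chart_map c x) (v c) (v c) +
    hessian (\<phi> \<circ> chart_inv c) (chart_map c x) (J x v c) (J x v c)"
proof -
  define f p S where "f = \<phi> \<circ> chart_inv c" and "p = chart_map c x"
    and "S = chart_map c ` (chart_dom c \<inter> \<Omega>)"
  have c: "c \<in> A" "x \<in> chart_dom c" unfolding c_def by (rule some_chart)+
  have f: "C_k_on 2 S f" unfolding f_def S_def by (rule C_2_in_chart)
  have S: "open S" "p \<in> S" using open_chart_image[OF c(1) open_domain] c x by (auto simp: S_def p_def)
  note h = bilinear_hessian[OF f S(2,1)]
  have rhess: "linear (hessian f p w)" for w using h by (simp add: bilinear_def)
  have alpha: "frechet_derivative (\<lambda>y. d_c A J \<phi> (chart_inv c y) (coord_vector A c (chart_inv c y) u)) (at p) w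
      = - hessian f p w (J_coord c p u)" for u w
  proof -
    obtain J' where J': "((\<lambda>y. J_coord c y u) has_derivative J') (at p)"
      using J_coord_differentiable[OF c(1)] c(2) by (auto simp: p_def differentiable_def)
    \<comment> \<open>Expanding \<open>J_coord c y u\<close> in the standard basis leaves
      derivatives of \<open>f\<close> in constant directions only, to which the product rule
      applies.\<close>
    have "((\<lambda>y. - (\<Sum>b\<in>Basis. (J_coord c y u \<bullet> b) * fderiv f y b)) has_derivative
        (\<lambda>w. - (\<Sum>b\<in>Basis. (J_coord c p u \<bullet> b) * hessian f p w b + (J' w \<bullet> b) * fderiv f p b))) (at p)"
      by (intro derivative_intros J' C_2_onD(2)[OF f S(2)])
    then have "((\<lambda>y. d_c A J \<phi> (chart_inv c y) (coord_vector A c (chart_inv c y) u)) has_derivative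
        (\<lambda>w. - (\<Sum>b\<in>Basis. (J_coord c p u \<bullet> b) * hessian f p w b + (J' w \<bullet> b) * fderiv f p b))) (at p)"
    proof (rule has_derivative_transform_within_open[OF _ S])
      fix y assume "y \<in> S"
      have "fderiv f y (J_coord c y u) = fderiv f y (\<Sum>b\<in>Basis. (J_coord c y u \<bullet> b) *\<^sub>R b)"
        by (simp add: euclidean_representation)
      also have "\<dots> = (\<Sum>b\<in>Basis. (J_coord c y u \<bullet> b) * fderiv f y b)"
        by (simp add: linear_sum[OF linear_fderiv[OF f \<open>y \<in> S\<close>]] linear_scale[OF linear_fderiv[OF f \<open>y \<in> S\<close>]])
      finally show "- (\<Sum>b\<in>Basis. (J_coord c y u \<bullet> b) * fderiv f y b) =
          d_c A J \<phi> (chart_inv c y) (coord_vector A c (chart_inv c y) u)"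
        using d_c_in_chart \<open>y \<in> S\<close> by (simp add: f_def S_def)
    qed
    \<comment> \<open>The terms with \<open>J'\<close> carry a factor \<open>fderiv f p b\<close>,
      which is zero by \<open>crit\<close>.\<close>
    then have "frechet_derivative (\<lambda>y. d_c A J \<phi> (chart_inv c y) (coord_vector A c (chart_inv c y) u)) (at p) w
        = - (\<Sum>b\<in>Basis. (J_coord c p u \<bullet> b) * hessian f p w b)"
      using crit by (simp add: f_def p_def flip: frechet_derivative_at)
    also have "(\<Sum>b\<in>Basis. (J_coord c p u \<bullet> b) * hessian f p w b) =
        hessian f p w (\<Sum>b\<in>Basis. (J_coord c p u \<bullet> b) *\<^sub>R b)"
      by (simp add: linear_sum[OF rhess] linear_scale[OF rhess])
    finally show ?thesis by (simp add: euclidean_representation)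
  qed
  have Jv: "J x v c = J_coord c p (v c)" using J_in_chart[OF c v] by (simp add: p_def)
  have "exterior_derivative A (d_c A J \<phi>) x v (J x v) =
      - hessian f p (v c) (J_coord c p (J x v c)) + hessian f p (J x v c) (J_coord c p (v c))"
    unfolding exterior_derivative_def Let_def c_def[symmetric] p_def[symmetric] alpha by simp
  \<comment> \<open>The relation \<open>J^2 = -1\<close> turns the negative first term into the
    Hessian value at \<open>v\<close>.\<close>
  also have "J_coord c p (J x v c) = - v c"
    using J_coord_squared[OF c] Jv by (simp add: p_def)
  also have "- hessian f p (v c) (- v c) + hessian f p (J x v c) (J_coord c p (v c)) =
      hessian f p (v c) (v c) + hessian f p (J x v c) (J x v c)"
    by (simp add: Jv bilinear_rneg[OF h])
  finally show ?thesis by (simp only: f_def p_def)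
qed

text \<open>The claim is proved in the chart and carried back by its homeomorphism. At a critical
  point, strict plurisubharmonicity and \<open>dd_c_critical\<close> give the positivity from which
  a positive plane arises; elsewhere a non-zero derivative suffices.\<close>

lemma strictly_psh_local_superlevel:
  assumes psh: "strictly_plurisubharmonic_on A J \<Omega> \<phi>" and dim: "DIM('e) > 2" and U: "open U" "x \<in> U"
  shows "\<exists>W. open W \<and> x \<in> W \<and> W \<subseteq> U \<inter> \<Omega> \<and> connected {y\<in>W. \<phi> y > \<phi> x} \<and> {y\<in>W. \<phi> y > \<phi> x} \<noteq> {}"
proof -
  define f p V where "f = \<phi> \<circ> chart_inv c" and "p = chart_map c x"
    and "V = chart_dom c \<inter> (U \<inter> \<Omega>)"
  define S where "S = chart_map c ` V"
  have c: "c \<in> A" "x \<in> chart_dom c" unfolding c_def by (rule some_chart)+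
  have "C_k_on 2 S f"
    unfolding f_def using C_2_in_chart by (rule C_2_on_subset) (auto simp: S_def V_def)
  note f = this
  have S: "open S" "p \<in> S"
    using open_chart_image[OF c(1) open_Int[OF U(1) open_domain]] c x U by (auto simp: S_def p_def V_def)
  have "\<exists>W. open W \<and> p \<in> W \<and> W \<subseteq> S \<and> connected {y\<in>W. f y > f p} \<and> {y\<in>W. f y > f p} \<noteq> {}"
  proof (cases "fderiv f p = (\<lambda>_. 0)")
    case False
    then show ?thesis using local_superlevel_regular[OF f S] by blast
  next
    case True
    have pos: "hessian f p u u + hessian f p (J_coord c p u) (J_coord c p u) > 0" if "u \<noteq> 0" for u
    proof -
      let ?v = "coord_vector A c x u"
      have v: "?v \<in> tangent_space A x" by (rule coord_vector_tangent[OF c])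
      have "?v c = u" by (rule coord_vector_self[OF c])
      then have "?v \<noteq> (\<lambda>c. 0)" using that by metis
      then have "exterior_derivative A (d_c A J \<phi>) x ?v (J x ?v) > 0"
        using psh x v by (auto simp: strictly_plurisubharmonic_on_def)
      then show ?thesis
        using dd_c_critical[OF _ v] True J_in_chart[OF c v] \<open>?v c = u\<close> by (simp add: f_def p_def)
    qed
    obtain v w where "hessian f p v v > 0" "hessian f p w w > 0" "hessian f p v w + hessian f p w v = 0"
    proof (rule exists_positive_plane[where h = "hessian f p" and J = "J_coord c p"])
      show "bilinear (hessian f p)" by (rule bilinear_hessian[OF f S(2,1)])
      show "linear (J_coord c p)" unfolding p_def by (rule linear_J_coord[OF c])
      show "J_coord c p (J_coord c p u) = - u" for u unfolding p_def by (rule J_coord_squared[OF c])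
    qed (use pos dim in auto)
    then show ?thesis using local_superlevel_critical[OF f S True] by blast
  qed
  then obtain W where "open W" "p \<in> W" "W \<subseteq> S" "connected {y\<in>W. f y > f p}" "{y\<in>W. f y > f p} \<noteq> {}"
    by blast
  then have "\<exists>W. open W \<and> x \<in> W \<and> W \<subseteq> V \<and> connected {y\<in>W. \<phi> y > \<phi> x} \<and> {y\<in>W. \<phi> y > \<phi> x} \<noteq> {}"
    unfolding f_def p_def S_def using local_superlevel_from_chart[OF c, of V W \<phi>] by (auto simp: V_def)
  then show ?thesis unfolding V_def by (meson Int_lower2 subset_trans)
qed

end

end

section \<open>Connectedness of the boundary of the domain\<close>

theorem theorem5:
  fixes A :: "('x::{t2_space,second_countable_topology}, 'e::euclidean_space) chart set"
    and J :: "'x \<Rightarrow> ('x, 'e) tangent_vector \<Rightarrow> ('x, 'e) tangent_vector"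
    and \<Omega> :: "'x set" and \<phi> :: "'x \<Rightarrow> real"
  assumes "almost_complex_manifold A J"
    and "DIM('e) \<ge> 4"
    and "relatively_compact_domain \<Omega>"
    and "C_k_function 2 A \<Omega> \<phi>"
    and "strictly_plurisubharmonic_on A J \<Omega> \<phi>"
    and "exhaustion_function \<Omega> \<phi>"
  shows "connected (frontier \<Omega>)"
proof -
  interpret almost_complex A J
    by unfold_locales (use assms(1) in \<open>auto simp: almost_complex_manifold_def\<close>)
  have \<Omega>: "open \<Omega>" using assms(3) by (simp add: relatively_compact_domain_def)
  interpret exhausted_domain \<Omega> \<phi>
  proof
    fix x U assume x: "x \<in> \<Omega>" and U: "open U" "x \<in> U"
    obtain W where W: "open W" "x \<in> W" "W \<subseteq> U \<inter> \<Omega>" "connected {y\<in>W. \<phi> y > \<phi> x}" "{y\<in>W. \<phi> y > \<phi> x} \<noteq> {}"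
      using strictly_psh_local_superlevel[OF \<Omega> assms(4) x assms(5) _ U] assms(2) by auto
    moreover have "{y \<in> W \<inter> \<Omega>. \<phi> y > \<phi> x} = {y\<in>W. \<phi> y > \<phi> x}" using W by blast
    ultimately show "\<exists>W. open W \<and> x \<in> W \<and> W \<subseteq> U \<and>
        connected {y \<in> W \<inter> \<Omega>. \<phi> y > \<phi> x} \<and> {y \<in> W \<inter> \<Omega>. \<phi> y > \<phi> x} \<noteq> {}"
      by (intro exI[of _ W]) auto
  qed (use assms C_2_function_continuous[OF \<Omega>] in auto)
  show ?thesis by (rule connected_frontier)
qed

end
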